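(* For every $n\ge1$, $$\dim\big(\mathbf{PQSym}^{*\infty}_n\big)=\sum_{k=1}^n A^{\infty}_{n,k}$$ and this number equals the number of rooted labeled non-planar trees on $[n]$ whose maximal decreasing subtree is a chain.
   Context: Words are finite words on $\mathbb{N}\setminus\{0\}$. A word $u=u_1\dots u_n$ is a parking function if its nondecreasing rearrangement $u'$ satisfies $u'_i\le i$ for all $i$; prime if moreover $u'_i<i$ for $i\ge 2$. Parkization: for $w$ of length $n$ let $d(w)=\min\{i\ge1:\#\{j:w_j\le i\}<i\}$; if $d(w)=n+1$ then $\mathrm{Park}(w)=w$, else $\mathrm{Park}(w)=\mathrm{Park}(w')$ with $w'$ obtained by decreasing by one all letters greater than $d(w)$. $\mathbf{PQSym}^*$ is the span over a field of characteristic $0$ of $\mathbf{G}_u=\sum_{\mathrm{Park}(w)=u}w$ ($u$ parking function), graded by the length of $u$. $\mathrm{BW}$: infinite sequences of columns $(L_i,M_i)$, $L_i$ finite sets of positive integers whose nonempty members form in order a set composition of $[n]$, $M_i$ a prime parking function of length $|L_i|$. With $\|L\|=|L|$ for $L\ne\emptyset$, $\|\emptyset\|=1$, the bijection $\Phi:\mathrm{BW}\to$ words sends $m$ to $w$ with $w_p=(t\text{-th letter of }M_j)+\sum_{q<j}\|L_q\|$ when $p$ is the $t$-th smallest element of $L_j$; words are identified with elements of $\mathrm{BW}$. The $\infty$-action of $\mathfrak{S}_\infty=\langle s_i=(i,i+1)\rangle$ on $\mathrm{BW}$ lets $s_i$ swap columns $i$ and $i+1$ (always); $\mathbf{PQSym}^{*\infty}$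 is the space of elements of $\mathbf{PQSym}^*$ invariant under this action (extended to words linearly), and $\mathbf{PQSym}^{*\infty}_n$ its intersection with the span of the $\mathbf{G}_u$, $u$ of length $n$. $A^{\infty}_{n,k}=\sum\prod_{i=1}^k(|Q_i|-1)^{|Q_i|-1}$, the sum over set partitions $\{Q_1,\dots,Q_k\}$ of $[n]$ into $k$ blocks, with $0^0=1$. For a rooted labeled tree $T$, its maximal decreasing subtree is the maximal subtree containing the root all of whose edges go from a parent to a child with smaller label; it is a chain if it is a path starting at the root. *)

theory Defs
  imports
    Complex_Main
    "HOL-Library.Function_Algebras"
    "HOL-Library.Disjoint_Sets"
    "HOL-Combinatorics.Transposition"
begin

section \<open>Words, parking functions, parkization\<close>

definition is_word :: "nat list \<Rightarrow> bool" where
  "is_word w \<longleftrightarrow> (\<forall>x\<in>set w. 1 \<le> x)"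

text \<open>List positions are counted from 0, so the letter \<open>u'\<^sub>i\<close> is \<open>sort u ! (i - 1)\<close>.\<close>

definition parking :: "nat list \<Rightarrow> bool" where
  "parking u \<longleftrightarrow> is_word u \<and> (\<forall>i\<in>{1..length u}. sort u ! (i - 1) \<le> i)"

definition prime_parking :: "nat list \<Rightarrow> bool" where
  "prime_parking u \<longleftrightarrow> parking u \<and> (\<forall>i\<in>{2..length u}. sort u ! (i - 1) < i)"

definition park_d :: "nat list \<Rightarrow> nat" where
  "park_d w = (LEAST i. 1 \<le> i \<and> card {j. j < length w \<and> w ! j \<le> i} < i)"

lemma park_d_le: "park_d w \<le> length w + 1"
proof -
  have "card {j. j < length w \<and> w ! j \<le> length w + 1} \<le> card {..<length w}"
    by (rule card_mono) auto
  then show ?thesis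
    unfolding park_d_def by (intro Least_le) auto
qed

lemma park_d_card: "card {j. j < length w \<and> w ! j \<le> park_d w} < park_d w"
proof -
  have "card {j. j < length w \<and> w ! j \<le> length w + 1} \<le> card {..<length w}"
    by (rule card_mono) auto
  then have "1 \<le> length w + 1 \<and> card {j. j < length w \<and> w ! j \<le> length w + 1} < length w + 1"
    by auto
  from LeastI[of "\<lambda>i. 1 \<le> i \<and> card {j. j < length w \<and> w ! j \<le> i} < i", OF this]
  show ?thesis unfolding park_d_def by blast
qed

lemma park_step_decreases:
  assumes "park_d w \<noteq> length w + 1"
  shows "sum_list (map (\<lambda>x. if park_d w < x then x - 1 else x) w) < sum_list w"
proof -
  have "park_d w \<le> length w" using assms park_d_le[of w] by simp
  then have lt: "card {j. j < length w \<and> w ! j \<le> park_d w} < length w"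
    using park_d_card[of w] by simp
  have "\<exists>x\<in>set w. park_d w < x"
  proof (rule ccontr)
    assume "\<not> ?thesis"
    then have "{j. j < length w \<and> w ! j \<le> park_d w} = {..<length w}"
      by (auto simp: not_less)
    with lt show False by simp
  qed
  moreover have "\<exists>x\<in>set w. d < x \<Longrightarrow>
      sum_list (map (\<lambda>x. if d < x then x - 1 else x) w) < sum_list w" for d
  proof (induction w)
    case (Cons a w)
    have le: "sum_list (map (\<lambda>x. if d < x then x - 1 else x) w) \<le> sum_list w"
      by (induction w) auto
    show ?case using Cons le by (cases "\<exists>x\<in>set w. d < x") auto
  qed simp
  ultimately show ?thesis by blast
qed

function park :: "nat list \<Rightarrow> nat list" where
  "park w = (if park_d w = length w + 1 then w
             else park (map (\<lambda>x. if park_d w < x then x - 1 else x) w))"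
  by auto
termination
  by (relation "measure sum_list") (auto simp del: sum_list_map_eq_sum_count intro: park_step_decreases)

declare park.simps [simp del]


section \<open>The algebra of parking functions as a space of series\<close>

text \<open>A formal (possibly infinite) linear combination of words is its coefficient function, and
  it vanishes outside \<^const>\<open>is_word\<close>.\<close>

definition scale_series :: "'k::field_char_0 \<Rightarrow> (nat list \<Rightarrow> 'k) \<Rightarrow> nat list \<Rightarrow> 'k" where
  "scale_series c f = (\<lambda>w. c * f w)"

global_interpretation series: vector_space scale_series
  by unfold_locales (auto simp: scale_series_def fun_eq_iff algebra_simps)

definition G :: "nat list \<Rightarrow> nat list \<Rightarrow> 'k::field_char_0" where
  "G u = (\<lambda>w. if is_word w \<and> park w = u then 1 else 0)"

definition PQSym :: "(nat list \<Rightarrow> 'k::field_char_0) set" where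
  "PQSym = series.span {G u | u. parking u}"

definition PQSym_comp :: "nat \<Rightarrow> (nat list \<Rightarrow> 'k::field_char_0) set" where
  "PQSym_comp n = series.span {G u | u. parking u \<and> length u = n}"


section \<open>Biwords and the action of the infinite symmetric group\<close>

text \<open>Columns \<open>(L\<^sub>i, M\<^sub>i)\<close> are indexed from 0.\<close>

type_synonym biword = "nat \<Rightarrow> nat set \<times> nat list"

definition BW :: "biword set" where
  "BW = {m. (\<exists>n. (\<Union>i. fst (m i)) = {1..n}) \<and>
            (\<forall>i j. i \<noteq> j \<longrightarrow> fst (m i) \<inter> fst (m j) = {}) \<and>
            (\<forall>i. prime_parking (snd (m i)) \<and> length (snd (m i)) = card (fst (m i)))}"

definition col_size :: "nat set \<Rightarrow> nat" where
  "col_size L = (if L = {} then 1 else card L)"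

text \<open>If \<open>p\<close> is the \<open>t\<close>-th smallest element of \<open>L\<close>, then \<open>t - 1\<close> elements of \<open>L\<close> are below \<open>p\<close>;
  this is the 0-based list position of the \<open>t\<close>-th letter of \<open>M\<close>.\<close>

definition Phi :: "biword \<Rightarrow> nat list" where
  "Phi m = map (\<lambda>p. let j = (THE j. p \<in> fst (m j))
                    in snd (m j) ! card {x \<in> fst (m j). x < p} + (\<Sum>q<j. col_size (fst (m q))))
               [1..<Suc (card (\<Union>i. fst (m i)))]"

inductive_set S_inf :: "(nat \<Rightarrow> nat) set" where
  id: "id \<in> S_inf"
| step: "\<sigma> \<in> S_inf \<Longrightarrow> transpose i (Suc i) \<circ> \<sigma> \<in> S_inf"

definition col_act :: "(nat \<Rightarrow> nat) \<Rightarrow> biword \<Rightarrow> biword" where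
  "col_act \<sigma> m = m \<circ> inv \<sigma>"

lemma col_act_transpose:
  "col_act (transpose i (Suc i)) m = m(i := m (Suc i), Suc i := m i)"
  by (auto simp: col_act_def fun_eq_iff transpose_def)

definition word_act :: "(nat \<Rightarrow> nat) \<Rightarrow> nat list \<Rightarrow> nat list" where
  "word_act \<sigma> w = Phi (col_act \<sigma> (the_inv_into BW Phi w))"

text \<open>Linear extension to series: the coefficient of \<open>\<sigma> \<cdot> w\<close> in \<open>\<sigma> \<cdot> f\<close> is that of \<open>w\<close> in \<open>f\<close>.\<close>

definition series_act :: "(nat \<Rightarrow> nat) \<Rightarrow> (nat list \<Rightarrow> 'k::field_char_0) \<Rightarrow> nat list \<Rightarrow> 'k" where
  "series_act \<sigma> f = (\<lambda>w. if is_word w then f (word_act (inv \<sigma>) w) else 0)"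

definition PQSym_inf :: "(nat list \<Rightarrow> 'k::field_char_0) set" where
  "PQSym_inf = {f \<in> PQSym. \<forall>\<sigma>\<in>S_inf. series_act \<sigma> f = f}"

definition PQSym_inf_comp :: "nat \<Rightarrow> (nat list \<Rightarrow> 'k::field_char_0) set" where
  "PQSym_inf_comp n = PQSym_inf \<inter> PQSym_comp n"


section \<open>Set partitions\<close>

definition A_inf :: "nat \<Rightarrow> nat \<Rightarrow> nat" where
  "A_inf n k = (\<Sum>P | partition_on {1..n} P \<and> card P = k. \<Prod>Q\<in>P. (card Q - 1) ^ (card Q - 1))"


section \<open>Rooted labeled trees\<close>

text \<open>A rooted tree is given by its root and its set of edges \<open>(parent, child)\<close>.\<close>

definition rooted_tree :: "nat set \<Rightarrow> nat \<Rightarrow> (nat \<times> nat) set \<Rightarrow> bool" where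
  "rooted_tree V r E \<longleftrightarrow>
     r \<in> V \<and> E \<subseteq> V \<times> V \<and> (\<forall>u. (u, r) \<notin> E) \<and>
     (\<forall>v\<in>V - {r}. \<exists>!u. (u, v) \<in> E) \<and> (\<forall>v\<in>V. (r, v) \<in> E\<^sup>*)"

text \<open>Subtrees are given by their vertex sets: a subgraph of a tree that is itself a tree is
  induced.\<close>

definition decreasing_subtree :: "nat \<Rightarrow> (nat \<times> nat) set \<Rightarrow> nat set \<Rightarrow> bool" where
  "decreasing_subtree r E S \<longleftrightarrow>
     rooted_tree S r (E \<inter> S \<times> S) \<and> (\<forall>(u, v) \<in> E \<inter> S \<times> S. v < u)"

definition max_decreasing_subtree ::
    "nat set \<Rightarrow> nat \<Rightarrow> (nat \<times> nat) set \<Rightarrow> nat set \<Rightarrow> bool" where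
  "max_decreasing_subtree V r E S \<longleftrightarrow>
     S \<subseteq> V \<and> decreasing_subtree r E S \<and>
     (\<forall>S'\<subseteq>V. decreasing_subtree r E S' \<and> S \<subseteq> S' \<longrightarrow> S' = S)"

definition chain_from :: "nat \<Rightarrow> (nat \<times> nat) set \<Rightarrow> nat set \<Rightarrow> bool" where
  "chain_from r E S \<longleftrightarrow>
     (\<exists>xs. xs \<noteq> [] \<and> hd xs = r \<and> distinct xs \<and> set xs = S \<and>
           E \<inter> S \<times> S = {(xs ! i, xs ! Suc i) | i. Suc i < length xs})"

definition chain_trees :: "nat \<Rightarrow> (nat \<times> (nat \<times> nat) set) set" where
  "chain_trees n =
     {(r, E). rooted_tree {1..n} r E \<and>
              (\<exists>S. max_decreasing_subtree {1..n} r E S \<and> chain_from r E S)}"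

end

theory Submission
  imports Defs "HOL-Library.FuncSet" "HOL-Library.Multiset" "HOL-Combinatorics.Permutations"
begin

text \<open>
  Permuting columns and deleting empty columns of a biword identify two words exactly when they have
  the same set of nonempty columns, and parkization deletes the empty columns one by one. So the
  indicator series of the sets of nonempty columns form a basis of the invariants, and there is one
  such set for each partition of \<open>[n]\<close> together with a prime parking function on each block.

  Cutting the edges of the decreasing chain of a tree leaves a forest in which every root is smaller
  than its children, and every such forest arises once, by linking its roots in decreasing order.
  This is a partition of \<open>[n]\<close> with such a tree on each block.

  Both structures on a block \<open>V\<close> are counted by \<open>\<Sum>\<^bsub>S\<^esub> F(|S| - 1, |V - S|)\<close>, the sum over the nonempty
  \<open>S \<subseteq> V\<close>, where \<open>F(a, b) = a (a + b)\<^bsup>b - 1\<^esup>\<close> counts generalised parking functions as well as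
  forests with prescribed roots: for both, removing the letters up to \<open>a\<close>, respectively the \<open>a\<close>
  roots, gives the recursion \<open>F(a, b) = \<Sum>\<^bsub>s\<^esub> (b choose s) a\<^bsup>s\<^esup> F(s, b - s)\<close>. For parking functions
  \<open>S\<close> is the set of positions of the letter 1, for trees it is the root with its children. The
  binomial theorem evaluates the sum to \<open>(|V| - 1)\<^bsup>|V| - 1\<^esup>\<close>.
\<close>

section \<open>Abel-type sums\<close>

text \<open>No bijection between prime parking functions and trees is built: both are classified by
  the same set \<open>S\<close>, and what remains has the same count \<open>F\<close>. The decrement
  in \<open>F(|S| - 1, _)\<close> has two origins. Primeness asks for one letter more than parking
  does at each value, so one letter 1 is spent; in a tree one element of \<open>S\<close> is the
  root itself, and only the others carry the hanging forest.

  Primeness also makes the columns of a word readable. The first \<open>i\<close> values of a column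
  of size \<open>l\<close> hold more than \<open>i\<close> letters for \<open>1 \<le> i < l\<close>,
  so the column ends where this surplus disappears; injectivity and surjectivity of
  \<open>Phi\<close> both rest on that. An empty column has size 1 because it stands for one missing
  value, the one that parkization closes up.

  The words with a given set of columns may be infinitely many, but parkization stays inside their
  class, so the indicator series is a finite sum of series \<open>G u\<close>.

  Maximality of the decreasing chain says that every edge leaving it goes up. After cutting the
  chain this is the condition that roots are smaller than their children.\<close>

definition abel_count :: "nat \<Rightarrow> nat \<Rightarrow> nat" where
  "abel_count a b = (if b = 0 then 1 else a * (a + b) ^ (b - 1))"

lemma sum_Pow_card:
  fixes g :: "nat \<Rightarrow> nat"
  assumes "finite V"
  shows "(\<Sum>S\<in>Pow V. g (card S)) = (\<Sum>s\<le>card V. (card V choose s) * g s)"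
proof -
  have "(\<Sum>S\<in>Pow V. g (card S)) = (\<Sum>s\<le>card V. \<Sum>S\<in>{S \<in> Pow V. card S = s}. g (card S))"
    using assms by (intro sum.group[symmetric]) (auto intro: card_mono)
  also have "\<dots> = (\<Sum>s\<le>card V. (card V choose s) * g s)"
    using n_subsets[OF assms] by (intro sum.cong) auto
  finally show ?thesis .
qed

lemma abel_count_0: "b > 0 \<Longrightarrow> abel_count 0 b = 0"
  by (simp add: abel_count_def)

text \<open>The factor \<open>s\<close> of \<open>abel_count s (b - s)\<close> is absorbed by
  \<open>s * (b choose s) = b * ((b - 1) choose (s - 1))\<close>. What remains is \<open>a\<close>
  times the binomial expansion of \<open>(a + b) ^ (b - 1)\<close>.\<close>

lemma abel_count_rec:
  "(\<Sum>s\<le>b. (b choose s) * (a ^ s * abel_count s (b - s))) = abel_count a b"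
proof (cases b)
  case 0
  then show ?thesis by (simp add: abel_count_def)
next
  case (Suc c)
  have summand: "(Suc c choose Suc t) * abel_count (Suc t) (c - t) = (c choose t) * Suc c ^ (c - t)"
    if "t \<le> c" for t
  \<comment> \<open>For \<open>t = c\<close> the second argument is 0. The power formula would have
    exponent -1 there; \<open>abel_count\<close> takes the value 1 instead.\<close>
  proof (cases "t = c")
    case True
    then show ?thesis by (simp add: abel_count_def)
  next
    case False
    with that obtain e where e: "c = t + Suc e" by (metis less_imp_Suc_add le_neq_implies_less add_Suc_right)
    have "(Suc c choose Suc t) * abel_count (Suc t) (c - t) = Suc t * (Suc c choose Suc t) * Suc c ^ e"
      by (simp add: abel_count_def e mult_ac del: binomial_Suc_Suc mult_Suc mult_Suc_right)
    also have "Suc t * (Suc c choose Suc t) = Suc c * (c choose t)"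
      by (rule Suc_times_binomial)
    also have "\<dots> * Suc c ^ e = (c choose t) * Suc c ^ Suc e"
      by (simp only: power_Suc mult_ac)
    finally show ?thesis by (simp only: e) simp
  qed
  have "(\<Sum>s\<le>b. (b choose s) * (a ^ s * abel_count s (b - s)))
      = (\<Sum>t\<le>c. (Suc c choose Suc t) * (a ^ Suc t * abel_count (Suc t) (c - t)))"
    unfolding Suc by (subst sum.atMost_Suc_shift) (simp add: abel_count_0)
  also have "\<dots> = (\<Sum>t\<le>c. a * ((c choose t) * a ^ t * Suc c ^ (c - t)))"
  proof (rule sum.cong)
    fix t assume "t \<in> {..c}"
    then have "(Suc c choose Suc t) * abel_count (Suc t) (c - t) = (c choose t) * Suc c ^ (c - t)"
      using summand by simp
    then have "a ^ Suc t * ((Suc c choose Suc t) * abel_count (Suc t) (c - t))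
      = a ^ Suc t * ((c choose t) * Suc c ^ (c - t))" by simp
    then show "(Suc c choose Suc t) * (a ^ Suc t * abel_count (Suc t) (c - t))
      = a * ((c choose t) * a ^ t * Suc c ^ (c - t))" by (simp only: mult_ac power_Suc)
  qed simp
  also have "\<dots> = a * (a + Suc c) ^ c"
    using binomial[of a "Suc c" c] by (simp add: sum_distrib_left)
  finally show ?thesis by (simp add: Suc abel_count_def)
qed

lemma abel_count_rec_Pow:
  assumes "finite V"
  shows "(\<Sum>S\<in>Pow V. a ^ card S * abel_count (card S) (card (V - S))) = abel_count a (card V)"
proof -
  have "(\<Sum>S\<in>Pow V. a ^ card S * abel_count (card S) (card (V - S)))
      = (\<Sum>S\<in>Pow V. a ^ card S * abel_count (card S) (card V - card S))"
    using assms by (intro sum.cong) (auto simp: card_Diff_subset finite_subset)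
  also have "\<dots> = abel_count a (card V)"
    using sum_Pow_card[OF assms, of "\<lambda>s. a ^ s * abel_count s (card V - s)"]
    by (simp add: abel_count_rec)
  finally show ?thesis .
qed

text \<open>With \<open>N = n - 1\<close>, the summand times \<open>N\<close> is
  \<open>(n choose s) * (s - 1) * N ^ (n - s)\<close>. Over all \<open>s \<le> n\<close>, the sums
  of \<open>s * (n choose s) * N ^ (n - s)\<close> and of \<open>(n choose s) * N ^ (n - s)\<close>
  both equal \<open>n ^ n\<close>, so their difference over \<open>s \<ge> 1\<close> is the term
  \<open>N ^ n\<close> that the second sum has at \<open>s = 0\<close>.\<close>

lemma sum_abel_count_pred:
  assumes "n \<ge> 1"
  shows "(\<Sum>s=1..n. (n choose s) * abel_count (s - 1) (n - s)) = (n - 1) ^ (n - 1)"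
proof -
  obtain N where n: "n = Suc N" using assms by (cases n) auto
  show ?thesis
  \<comment> \<open>The factor \<open>N\<close> avoids a negative exponent at \<open>s = n\<close>;
    it can be cancelled at the end only if it is nonzero.\<close>
  proof (cases "N = 0")
    case True
    then show ?thesis by (simp add: n abel_count_def)
  next
    case False
    have summand: "N * ((n choose s) * abel_count (s - 1) (n - s)) = (n choose s) * (s - 1) * N ^ (n - s)"
      if s: "s \<in> {1..n}" for s
    proof (cases "s = n")
      case True
      then show ?thesis by (simp add: abel_count_def n)
    next
      case False
      with s obtain t where t: "s = Suc t" "t < N" by (cases s) (auto simp: n)
      then obtain e where e: "N = t + Suc e" by (metis less_imp_Suc_add add_Suc_right)
      show ?thesis by (simp add: abel_count_def n t e mult_ac del: binomial_Suc_Suc mult_Suc mult_Suc_right)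
    qed
    have A: "(\<Sum>s\<le>n. s * (n choose s) * N ^ (n - s)) = n ^ n"
    proof -
      have "(\<Sum>s\<le>n. s * (n choose s) * N ^ (n - s))
          = (\<Sum>t\<le>N. Suc t * (Suc N choose Suc t) * N ^ (N - t))"
        unfolding n by (subst sum.atMost_Suc_shift) simp
      also have "\<dots> = (\<Sum>t\<le>N. Suc N * (N choose t) * N ^ (N - t))"
        by (simp only: Suc_times_binomial)
      also have "\<dots> = Suc N * (1 + N) ^ N"
        using binomial[of 1 N N] by (simp add: sum_distrib_left mult.assoc del: mult_Suc)
      finally show ?thesis by (simp add: n)
    qed
    have B: "(\<Sum>s\<le>n. (n choose s) * N ^ (n - s)) = n ^ n"
      using binomial[of 1 N n] by (simp add: n)
    have "(\<Sum>s\<le>n. (n choose s) * N ^ (n - s)) = N ^ n + (\<Sum>s=1..n. (n choose s) * N ^ (n - s))"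
      by (simp add: sum.atLeast_Suc_atMost atMost_atLeast0)
    moreover have "(\<Sum>s\<le>n. s * (n choose s) * N ^ (n - s)) = (\<Sum>s=1..n. s * (n choose s) * N ^ (n - s))"
      by (simp add: sum.atLeast_Suc_atMost atMost_atLeast0)
    moreover have "(\<Sum>s=1..n. s * (n choose s) * N ^ (n - s))
        = (\<Sum>s=1..n. (n choose s) * (s - 1) * N ^ (n - s)) + (\<Sum>s=1..n. (n choose s) * N ^ (n - s))"
      unfolding sum.distrib[symmetric]
    proof (rule sum.cong)
      fix s assume "s \<in> {1..n}"
      then obtain t where "s = Suc t" by (cases s) auto
      then show "s * (n choose s) * N ^ (n - s)
          = (n choose s) * (s - 1) * N ^ (n - s) + (n choose s) * N ^ (n - s)"
        by (simp add: algebra_simps)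
    qed simp
    ultimately have "(\<Sum>s=1..n. (n choose s) * (s - 1) * N ^ (n - s)) = N ^ n"
      using A B by linarith
    then have "N * (\<Sum>s=1..n. (n choose s) * abel_count (s - 1) (n - s)) = N * N ^ N"
      unfolding sum_distrib_left by (subst sum.cong[OF refl summand]) (auto simp: n)
    then show ?thesis using False by (simp add: n)
  qed
qed

lemma sum_abel_count_Pow:
  assumes "finite V" "V \<noteq> {}"
  shows "(\<Sum>S\<in>Pow V - {{}}. abel_count (card S - 1) (card (V - S))) = (card V - 1) ^ (card V - 1)"
proof -
  define g where "g s = (if s = 0 then 0 else abel_count (s - 1) (card V - s))" for s
  have "(\<Sum>S\<in>Pow V - {{}}. abel_count (card S - 1) (card (V - S))) = (\<Sum>S\<in>Pow V - {{}}. g (card S))"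
    using assms by (intro sum.cong) (auto simp: g_def card_Diff_subset finite_subset)
  also have "\<dots> = (\<Sum>S\<in>Pow V. g (card S))"
    using assms by (intro sum.mono_neutral_left) (auto simp: g_def)
  also have "\<dots> = (\<Sum>s\<le>card V. (card V choose s) * g s)"
    by (rule sum_Pow_card[OF assms(1)])
  also have "\<dots> = (\<Sum>s=1..card V. (card V choose s) * g s)"
    by (intro sum.mono_neutral_right) (auto simp: g_def)
  also have "\<dots> = (\<Sum>s=1..card V. (card V choose s) * abel_count (s - 1) (card V - s))"
    by (intro sum.cong) (auto simp: g_def)
  also have "\<dots> = (card V - 1) ^ (card V - 1)"
    using assms by (intro sum_abel_count_pred) (simp add: Suc_leI card_gt_0_iff)
  finally show ?thesis .
qed

section \<open>Counting prime parking functions\<close>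

text \<open>Letters start at 0 here. For finite \<open>V\<close> the condition says that the
  \<open>i\<close>-th smallest letter, with \<open>i\<close> counted from 1, is less than
  \<open>a + i - 1\<close>; ordinary parking functions are the case \<open>a = 1\<close>. Positions
  form an arbitrary set so that some of them can be removed.\<close>

definition park_funs :: "nat \<Rightarrow> 'a set \<Rightarrow> ('a \<Rightarrow> nat) set" where
  "park_funs a V = {u \<in> V \<rightarrow>\<^sub>E UNIV. \<forall>j<a + card V. j < card {p \<in> V. u p < j} + a}"

lemma finite_park_funs:
  assumes "finite V"
  shows "finite (park_funs a V)"
proof (rule finite_subset)
  show "park_funs a V \<subseteq> V \<rightarrow>\<^sub>E {..<a + card V}"
  proof
    fix u assume u: "u \<in> park_funs a V"
    have "u p < a + card V" if "p \<in> V" for p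
    proof -
      have "card V > 0" using that assms by (auto simp: card_gt_0_iff)
      \<comment> \<open>The last condition, at \<open>j = a + card V - 1\<close>, bounds all letters
        at once.\<close>
      then have "a + card V - 1 < card {p \<in> V. u p < a + card V - 1} + a"
        using u by (auto simp: park_funs_def)
      then have "card V \<le> card {p \<in> V. u p < a + card V - 1}" by linarith
      then have "{p \<in> V. u p < a + card V - 1} = V"
        using assms by (intro card_seteq) auto
      then have "u p < a + card V - 1" using that by blast
      then show ?thesis by simp
    qed
    then show "u \<in> V \<rightarrow>\<^sub>E {..<a + card V}"
      using u by (auto simp: park_funs_def PiE_def)
  qed
  show "finite (V \<rightarrow>\<^sub>E {..<a + card V})" using assms by (intro finite_PiE) auto
qed

lemma park_funs_empty: "park_funs a {} = {\<lambda>_. undefined}"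
  by (auto simp: park_funs_def)

lemma park_funs_0:
  assumes "finite V" "V \<noteq> {}"
  shows "park_funs 0 V = {}"
proof -
  have "card V > 0" using assms by (simp add: card_gt_0_iff)
  then show ?thesis by (auto simp: park_funs_def)
qed

text \<open>Inverse of cutting a function at the threshold \<open>c\<close>: \<open>S\<close> holds
  the positions of the values below \<open>c\<close>, and the other values are stored lowered by
  \<open>c\<close>. Generalised parking functions are cut at \<open>c = a\<close>, prime ones at
  \<open>c = 1\<close>.\<close>

definition glue_letters :: "'a set \<Rightarrow> nat \<Rightarrow> 'a set \<Rightarrow> ('a \<Rightarrow> nat) \<Rightarrow> ('a \<Rightarrow> nat) \<Rightarrow> 'a \<Rightarrow> nat" where
  "glue_letters V c S g v = (\<lambda>p\<in>V. if p \<in> S then g p else v p + c)"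

lemma bij_betw_glue_letters:
  "bij_betw (\<lambda>(S, g, v). glue_letters V c S g v)
     (SIGMA S:Pow V. (S \<rightarrow>\<^sub>E {..<c}) \<times> ((V - S) \<rightarrow>\<^sub>E UNIV)) (V \<rightarrow>\<^sub>E UNIV)"
proof (rule bij_betw_byWitness[where f' = "\<lambda>u. let S = {p \<in> V. u p < c} in
    (S, restrict u S, \<lambda>p\<in>V - S. u p - c)"])
  show "\<forall>x\<in>(SIGMA S:Pow V. (S \<rightarrow>\<^sub>E {..<c}) \<times> ((V - S) \<rightarrow>\<^sub>E UNIV)).
      (\<lambda>u. let S = {p \<in> V. u p < c} in (S, restrict u S, \<lambda>p\<in>V - S. u p - c))
        ((\<lambda>(S, g, v). glue_letters V c S g v) x) = x"
  proof (clarify, goal_cases)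
    case (1 S g v)
    then have S: "S \<subseteq> V" and g: "g \<in> S \<rightarrow>\<^sub>E {..<c}" and v: "v \<in> (V - S) \<rightarrow>\<^sub>E UNIV"
      by blast+
    have 1: "{p \<in> V. glue_letters V c S g v p < c} = S"
      using S g by (auto simp: glue_letters_def PiE_iff split: if_splits)
    have 2: "restrict (glue_letters V c S g v) S = g"
      using S g by (auto simp: glue_letters_def fun_eq_iff restrict_def PiE_def extensional_def)
    have 3: "(\<lambda>p\<in>V - S. glue_letters V c S g v p - c) = v"
      using v by (auto simp: glue_letters_def fun_eq_iff restrict_def PiE_def extensional_def)
    show ?case unfolding split 1 Let_def 2 3 ..
  qed
  show "\<forall>u\<in>V \<rightarrow>\<^sub>E UNIV. (\<lambda>(S, g, v). glue_letters V c S g v)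
      (let S = {p \<in> V. u p < c} in (S, restrict u S, \<lambda>p\<in>V - S. u p - c)) = u"
    by (auto simp: glue_letters_def fun_eq_iff Let_def PiE_def extensional_def)
qed (auto simp: glue_letters_def Let_def PiE_iff extensional_def split: if_splits)

lemma card_glue_letters_less:
  assumes "finite V" "S \<subseteq> V" "g \<in> S \<rightarrow>\<^sub>E {..<c}" "c \<le> j"
  shows "card {p \<in> V. glue_letters V c S g v p < j} = card S + card {p \<in> V - S. v p < j - c}"
proof -
  have "{p \<in> V. glue_letters V c S g v p < j} = S \<union> {p \<in> V - S. v p < j - c}"
  proof (intro set_eqI iffI)
    fix p assume "p \<in> S \<union> {p \<in> V - S. v p < j - c}"
    then show "p \<in> {p \<in> V. glue_letters V c S g v p < j}"
      using assms(2-4) by (auto simp: glue_letters_def PiE_iff)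
  qed (auto simp: glue_letters_def split: if_splits)
  then show ?thesis
    using assms by (simp add: finite_subset card_Un_disjoint disjoint_iff)
qed

text \<open>The bijection is established once between the unconstrained sets; a constrained version
  then only needs the equivalence of the two constraints.\<close>

lemma bij_betw_restrict_preimage:
  assumes "bij_betw f A B" "A' \<subseteq> A" "\<And>x. x \<in> A \<Longrightarrow> x \<in> A' \<longleftrightarrow> f x \<in> B'" "B' \<subseteq> B"
  shows "bij_betw f A' B'"
proof -
  have "f ` A' = B'"
  proof
    show "f ` A' \<subseteq> B'" using assms by blast
    show "B' \<subseteq> f ` A'"
    proof
      fix y assume "y \<in> B'"
      moreover then obtain x where "x \<in> A" "f x = y" using assms by (auto simp: bij_betw_def)
      ultimately show "y \<in> f ` A'" using assms(3)[of x] by blast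
    qed
  qed
  then show ?thesis using bij_betw_subset[OF assms(1,2)] by simp
qed

text \<open>Removing the letters below \<open>a\<close>, at the set \<open>S\<close> of positions, leaves a parking function with
  \<open>card S\<close> in place of \<open>a\<close>.\<close>

lemma park_funs_rec:
  assumes V: "finite V"
  shows "card (park_funs a V) = (\<Sum>S\<in>Pow V. a ^ card S * card (park_funs (card S) (V - S)))"
proof -
  let ?X = "SIGMA S:Pow V. (S \<rightarrow>\<^sub>E {..<a}) \<times> park_funs (card S) (V - S)"
  have "bij_betw (\<lambda>(S, g, v). glue_letters V a S g v) ?X (park_funs a V)"
  proof (rule bij_betw_restrict_preimage[OF bij_betw_glue_letters])
    show "?X \<subseteq> (SIGMA S:Pow V. (S \<rightarrow>\<^sub>E {..<a}) \<times> (V - S \<rightarrow>\<^sub>E UNIV))"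
      by (auto simp: park_funs_def)
    show "park_funs a V \<subseteq> V \<rightarrow>\<^sub>E UNIV" by (auto simp: park_funs_def)
    fix x assume "x \<in> (SIGMA S:Pow V. (S \<rightarrow>\<^sub>E {..<a}) \<times> (V - S \<rightarrow>\<^sub>E (UNIV::nat set)))"
    then obtain S g v where x: "x = (S, g, v)" and S: "S \<subseteq> V" and g: "g \<in> S \<rightarrow>\<^sub>E {..<a}"
      and v: "v \<in> V - S \<rightarrow>\<^sub>E UNIV" by auto
    let ?u = "glue_letters V a S g v"
    have u: "?u \<in> V \<rightarrow>\<^sub>E UNIV" by (simp add: glue_letters_def)
    have cV: "card V = card S + card (V - S)"
      using S V by (metis card_Diff_subset card_mono finite_subset le_add_diff_inverse)
    \<comment> \<open>The substitution \<open>j = a + k\<close> matches the two ranges because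
      \<open>card V = card S + card (V - S)\<close>; the \<open>card S\<close> letters below
      \<open>a\<close> become the new parameter.\<close>
    have "(\<forall>j<a + card V. j < card {p \<in> V. ?u p < j} + a)
      \<longleftrightarrow> (\<forall>k<card S + card (V - S). k < card {p \<in> V - S. v p < k} + card S)" (is "?l \<longleftrightarrow> ?r")
    proof
      assume l: ?l
      show ?r
      proof (intro allI impI)
        fix k assume "k < card S + card (V - S)"
        then have "a + k < card {p \<in> V. ?u p < a + k} + a" using l cV by simp
        then show "k < card {p \<in> V - S. v p < k} + card S"
          using card_glue_letters_less[OF V S g, of "a + k" v] by simp
      qed
    next
      assume r: ?r
      show ?l
      proof (intro allI impI)
        fix j assume j: "j < a + card V"
        show "j < card {p \<in> V. ?u p < j} + a"
        proof (cases "j < a")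
          case False
          then have "j - a < card {p \<in> V - S. v p < j - a} + card S" using r j cV by auto
          then show ?thesis using card_glue_letters_less[OF V S g, of j v] False by simp
        qed simp
      qed
    qed
    then show "x \<in> ?X \<longleftrightarrow> (\<lambda>(S, g, v). glue_letters V a S g v) x \<in> park_funs a V"
      using S g v u by (simp add: x park_funs_def)
  qed
  then have "card (park_funs a V) = card ?X" by (simp add: bij_betw_same_card)
  also have "\<dots> = (\<Sum>S\<in>Pow V. a ^ card S * card (park_funs (card S) (V - S)))"
    using V by (subst card_SigmaI)
      (auto simp: finite_park_funs finite_PiE finite_subset card_cartesian_product card_PiE intro!: sum.cong)
  finally show ?thesis .
qed

lemma card_park_funs:
  assumes "finite V"
  shows "card (park_funs a V) = abel_count a (card V)"
  using assms
proof (induction V arbitrary: a rule: finite_psubset_induct)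
  case (psubset V)
  show ?case
  proof (cases "V = {}")
    case True
    then show ?thesis by (simp add: park_funs_empty abel_count_def)
  next
    case False
    have "card (park_funs (card S) (V - S)) = abel_count (card S) (card (V - S))" if "S \<in> Pow V" for S
    \<comment> \<open>For empty \<open>S\<close> the set \<open>V - S\<close> is \<open>V\<close>
      itself and the induction hypothesis does not apply; both sides are 0 there.\<close>
    proof (cases "S = {}")
      case True
      then show ?thesis
        using False psubset.hyps by (simp add: park_funs_0 abel_count_0 card_gt_0_iff)
    next
      case S: False
      then show ?thesis using that by (intro psubset.IH) auto
    qed
    then show ?thesis
      unfolding park_funs_rec[OF psubset.hyps] by (simp add: abel_count_rec_Pow[OF psubset.hyps])
  qed
qed

text \<open>Letters start at 0 again. The occurrence of the letter 0 settles singletons, for which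
  the range of \<open>j\<close> is empty.\<close>

definition prime_park_funs :: "'a set \<Rightarrow> ('a \<Rightarrow> nat) set" where
  "prime_park_funs V = {u \<in> V \<rightarrow>\<^sub>E UNIV. {p \<in> V. u p < 1} \<noteq> {} \<and>
     (\<forall>j\<in>{1..<card V}. j < card {p \<in> V. u p < j})}"

text \<open>\<open>S\<close> is the set of positions of the letter 0. At \<open>j = 1 + k\<close>
  primeness reads \<open>1 + k < card S + card {p \<in> V - S. v p < k}\<close>, where
  \<open>v\<close> holds the other letters lowered by 1: the generalised condition with parameter
  \<open>card S - 1\<close>.\<close>

lemma card_prime_park_funs:
  assumes V: "finite V" and ne: "V \<noteq> {}"
  shows "card (prime_park_funs V) = (card V - 1) ^ (card V - 1)"
proof -
  let ?X = "SIGMA S:Pow V - {{}}. (S \<rightarrow>\<^sub>E {..<1::nat}) \<times> park_funs (card S - 1) (V - S)"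
  have "bij_betw (\<lambda>(S, g, v). glue_letters V 1 S g v) ?X (prime_park_funs V)"
  proof (rule bij_betw_restrict_preimage[OF bij_betw_glue_letters])
    show "?X \<subseteq> (SIGMA S:Pow V. (S \<rightarrow>\<^sub>E {..<1}) \<times> (V - S \<rightarrow>\<^sub>E UNIV))"
      by (auto simp: park_funs_def)
    show "prime_park_funs V \<subseteq> V \<rightarrow>\<^sub>E UNIV" by (auto simp: prime_park_funs_def)
    fix x assume "x \<in> (SIGMA S:Pow V. (S \<rightarrow>\<^sub>E {..<1::nat}) \<times> (V - S \<rightarrow>\<^sub>E (UNIV::nat set)))"
    then obtain S g v where x: "x = (S, g, v)" and S: "S \<subseteq> V" and g: "g \<in> S \<rightarrow>\<^sub>E {..<1}"
      and v: "v \<in> V - S \<rightarrow>\<^sub>E UNIV" by auto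
    let ?u = "glue_letters V 1 S g v"
    have u: "?u \<in> V \<rightarrow>\<^sub>E UNIV" by (simp add: glue_letters_def)
    have cV: "card V = card S + card (V - S)"
      using S V by (metis card_Diff_subset card_mono finite_subset le_add_diff_inverse)
    have u1: "{p \<in> V. ?u p < 1} = S"
      using S g by (auto simp: glue_letters_def PiE_iff split: if_splits)
    have "(\<forall>j\<in>{1..<card V}. j < card {p \<in> V. ?u p < j})
      \<longleftrightarrow> (\<forall>k<(card S - 1) + card (V - S). k < card {p \<in> V - S. v p < k} + (card S - 1))" (is "?l \<longleftrightarrow> ?r")
      if "S \<noteq> {}"
    proof
      have S0: "card S > 0" using that S V by (auto simp: card_gt_0_iff finite_subset)
      show ?r if l: ?l
      proof (intro allI impI)
        fix k assume "k < (card S - 1) + card (V - S)"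
        then have "1 + k < card {p \<in> V. ?u p < 1 + k}" using l cV S0 by simp
        then show "k < card {p \<in> V - S. v p < k} + (card S - 1)"
          using card_glue_letters_less[OF V S g, of "1 + k" v] by simp
      qed
      show ?l if r: ?r
      proof
        fix j assume j: "j \<in> {1..<card V}"
        then have "j - 1 < card {p \<in> V - S. v p < j - 1} + (card S - 1)" using r cV S0 by auto
        then show "j < card {p \<in> V. ?u p < j}"
          using card_glue_letters_less[OF V S g, of j v] j S0 by simp
      qed
    qed
    then show "x \<in> ?X \<longleftrightarrow> (\<lambda>(S, g, v). glue_letters V 1 S g v) x \<in> prime_park_funs V"
      unfolding x split prime_park_funs_def mem_Collect_eq u1 using S g v u
      by (cases "S = {}") (simp_all add: park_funs_def)
  qed
  then have "card (prime_park_funs V) = card ?X" by (simp add: bij_betw_same_card)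
  also have "\<dots> = (\<Sum>S\<in>Pow V - {{}}. card (park_funs (card S - 1) (V - S)))"
    using V by (subst card_SigmaI)
      (auto simp: finite_park_funs finite_PiE finite_subset card_cartesian_product card_PiE intro!: sum.cong)
  also have "\<dots> = (card V - 1) ^ (card V - 1)"
    using V sum_abel_count_Pow[OF V ne] by (simp add: card_park_funs)
  finally show ?thesis .
qed

section \<open>Prime parking functions as words\<close>

definition letters_le :: "nat list \<Rightarrow> nat \<Rightarrow> nat" where
  "letters_le u i = card {j. j < length u \<and> u ! j \<le> i}"

lemma letters_le_mset_eq:
  assumes "mset u = mset v"
  shows "letters_le u i = letters_le v i"
proof -
  have "letters_le u i = size (filter_mset (\<lambda>x. x \<le> i) (mset u))" for u :: "nat list"
    unfolding letters_le_def
    by (subst length_filter_conv_card[symmetric]) (simp flip: size_mset mset_filter)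
  then show ?thesis using assms by simp
qed

lemma sort_nth_le_iff:
  assumes "k < length u"
  shows "sort u ! k \<le> x \<longleftrightarrow> k < letters_le u x"
proof -
  let ?v = "sort u"
  have *: "letters_le u x = letters_le ?v x" by (rule letters_le_mset_eq) simp
  have len: "k < length ?v" using assms by simp
  show ?thesis
  proof
    assume "?v ! k \<le> x"
    then have "{..k} \<subseteq> {j. j < length ?v \<and> ?v ! j \<le> x}"
      using len by (auto intro: order_trans[OF sorted_nth_mono[OF sorted_sort]])
    from card_mono[OF _ this] show "k < letters_le u x" unfolding * unfolding letters_le_def by simp
  next
    assume k: "k < letters_le u x"
    show "?v ! k \<le> x"
    proof (rule ccontr)
      assume "\<not> ?v ! k \<le> x"
      then have "{j. j < length ?v \<and> ?v ! j \<le> x} \<subseteq> {..<k}"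
        using sorted_nth_mono[OF sorted_sort, of k _ u] by (fastforce simp: not_le)
      from card_mono[OF _ this] k show False unfolding * unfolding letters_le_def by simp
    qed
  qed
qed

lemma parking_iff:
  "parking u \<longleftrightarrow> is_word u \<and> (\<forall>i\<in>{1..length u}. i \<le> letters_le u i)"
  unfolding parking_def by (intro conj_cong refl ball_cong) (auto simp: sort_nth_le_iff)

text \<open>Shifting the index by one turns the strict bounds on the sorted word into strict bounds
  on letter counts. In length 1 these bounds are void, so the letter 1 is asked for
  separately.\<close>

lemma prime_parking_iff:
  "prime_parking u \<longleftrightarrow> is_word u \<and> (\<forall>i\<in>{1..<length u}. i < letters_le u i)
     \<and> (u \<noteq> [] \<longrightarrow> 1 \<in> set u)"
proof -
  have one: "1 \<in> set u \<longleftrightarrow> 1 \<le> letters_le u 1" if "is_word u"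
  proof -
    have "1 \<le> letters_le u 1 \<longleftrightarrow> {j. j < length u \<and> u ! j \<le> 1} \<noteq> {}"
      unfolding letters_le_def by (simp add: Suc_le_eq card_gt_0_iff)
    also have "\<dots> \<longleftrightarrow> 1 \<in> set u"
      using that by (auto simp: is_word_def in_set_conv_nth) (metis One_nat_def le_antisym nth_mem)
    finally show ?thesis by simp
  qed
  have mono: "letters_le u i \<le> letters_le u j" if "i \<le> j" for i j
    unfolding letters_le_def using that by (intro card_mono) auto
  have two: "(\<forall>i\<in>{2..length u}. sort u ! (i - 1) < i) \<longleftrightarrow> (\<forall>i\<in>{1..<length u}. i < letters_le u i)"
  proof -
    have "(\<forall>i\<in>{2..length u}. sort u ! (i - 1) < i) \<longleftrightarrow> (\<forall>i\<in>{1..<length u}. sort u ! i < Suc i)"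
    proof
      assume *: "\<forall>i\<in>{2..length u}. sort u ! (i - 1) < i"
      show "\<forall>i\<in>{1..<length u}. sort u ! i < Suc i"
        using * by (metis Suc_1 Suc_le_mono Suc_leI atLeastAtMost_iff atLeastLessThan_iff diff_Suc_1)
    next
      assume *: "\<forall>i\<in>{1..<length u}. sort u ! i < Suc i"
      show "\<forall>i\<in>{2..length u}. sort u ! (i - 1) < i"
      proof
        fix i assume "i \<in> {2..length u}"
        then show "sort u ! (i - 1) < i" using *[rule_format, of "i - 1"] by (cases i) auto
      qed
    qed
    then show ?thesis by (auto simp: less_Suc_eq_le sort_nth_le_iff)
  qed
  show ?thesis
  proof (cases "is_word u")
    case w: True
    show ?thesis
    proof (cases "u = []")
      case False
      have "(\<forall>i\<in>{1..length u}. i \<le> letters_le u i)"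
        if a: "\<forall>i\<in>{1..<length u}. i < letters_le u i" and b: "1 \<in> set u"
      proof
        fix i assume i: "i \<in> {1..length u}"
        show "i \<le> letters_le u i"
        \<comment> \<open>At the last index, if it is not 1, the strict bound at
          \<open>i - 1\<close> already supplies \<open>i\<close> letters.\<close>
        proof (cases "i = length u \<and> i \<noteq> 1")
          case True
          then have "i - 1 \<in> {1..<length u}" using i by auto
          then have "i - 1 < letters_le u (i - 1)" using a by blast
          also have "\<dots> \<le> letters_le u i" by (rule mono) simp
          finally show ?thesis by simp
        next
          case F: False
          then show ?thesis using a b i one[OF w] by (cases "i = 1") (auto simp: less_imp_le)
        qed
      qed
      moreover have "1 \<in> set u" if "\<forall>i\<in>{1..length u}. i \<le> letters_le u i"
        using that[rule_format, of 1] False one[OF w] by (simp add: Suc_le_eq)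
      ultimately show ?thesis
        unfolding prime_parking_def two parking_iff using w False by blast
    qed (auto simp: prime_parking_def parking_def is_word_def)
  qed (auto simp: prime_parking_def parking_def)
qed

lemma card_prime_parking:
  assumes "n \<ge> 1"
  shows "card {u. prime_parking u \<and> length u = n} = (n - 1) ^ (n - 1)"
proof -
  have "bij_betw (\<lambda>u. \<lambda>j\<in>{..<n}. u ! j - 1) {u. prime_parking u \<and> length u = n} (prime_park_funs {..<n})"
  proof (rule bij_betw_byWitness[where f' = "\<lambda>u. map (\<lambda>j. u j + 1) [0..<n]"])
    have W: "letters_le w i = card {p \<in> {..<n}. w ! p - 1 < i}" if "is_word w" "length w = n" "1 \<le> i" for w i
      unfolding letters_le_def using that
      by (intro arg_cong[where f = card]) (fastforce simp: is_word_def dest: nth_mem)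
    show "(\<lambda>u. \<lambda>j\<in>{..<n}. u ! j - 1) ` {u. prime_parking u \<and> length u = n} \<subseteq> prime_park_funs {..<n}"
    proof clarify
      fix u assume u: "prime_parking u" "n = length u"
      then have w: "is_word u" "1 \<in> set u" using assms by (auto simp: prime_parking_iff)
      then obtain j where "j < length u" "u ! j = 1" by (auto simp: in_set_conv_nth)
      moreover have "{p \<in> {..<n}. (\<lambda>j\<in>{..<n}. u ! j - 1) p < i} = {p \<in> {..<n}. u ! p - 1 < i}" for i by auto
      ultimately show "(\<lambda>j\<in>{..<length u}. u ! j - 1) \<in> prime_park_funs {..<length u}"
        using u w W[of u] by (auto simp: prime_park_funs_def prime_parking_iff intro!: exI[of _ j])
    qed
    show "(\<lambda>u. map (\<lambda>j. u j + 1) [0..<n]) ` prime_park_funs {..<n} \<subseteq> {u. prime_parking u \<and> length u = n}"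
    proof clarify
      fix u :: "nat \<Rightarrow> nat" assume u: "u \<in> prime_park_funs {..<n}"
      let ?w = "map (\<lambda>j. u j + 1) [0..<n]"
      have w: "is_word ?w" by (auto simp: is_word_def)
      have "{p \<in> {..<n}. ?w ! p - 1 < i} = {p \<in> {..<n}. u p < i}" for i by auto
      then have "letters_le ?w i = card {p \<in> {..<n}. u p < i}" if "1 \<le> i" for i
        using W[of ?w i] w that by simp
      then show "prime_parking ?w \<and> length ?w = n"
        using u w by (auto simp: prime_park_funs_def prime_parking_iff image_iff)
    qed
    show "\<forall>u\<in>{u. prime_parking u \<and> length u = n}. map (\<lambda>j. (\<lambda>j\<in>{..<n}. u ! j - 1) j + 1) [0..<n] = u"
      by (auto simp: prime_parking_iff is_word_def intro!: nth_equalityI) (metis Suc_pred nth_mem Suc_le_lessD)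
  qed (auto simp: prime_park_funs_def fun_eq_iff PiE_def extensional_def)
  then show ?thesis
    using card_prime_park_funs[of "{..<n}"] assms by (simp add: bij_betw_same_card lessThan_empty_iff)
qed

section \<open>Counting forests\<close>

text \<open>These are the converse graphs of the functions from \<open>S\<close> to
  \<open>A\<close>, kept as edge sets so that they can be united with a forest.\<close>

definition arrows :: "'a set \<Rightarrow> 'b set \<Rightarrow> ('a \<times> 'b) set set" where
  "arrows A S = {D. D \<subseteq> A \<times> S \<and> (\<forall>s\<in>S. \<exists>!a. (a, s) \<in> D)}"

lemma card_arrows:
  assumes "finite S"
  shows "card (arrows A S) = card A ^ card S"
proof -
  have "bij_betw (\<lambda>g. (\<lambda>s. (g s, s)) ` S) (S \<rightarrow>\<^sub>E A) (arrows A S)"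
  proof (rule bij_betw_byWitness[where f' = "\<lambda>D. \<lambda>s\<in>S. THE a. (a, s) \<in> D"])
    show "\<forall>g\<in>S \<rightarrow>\<^sub>E A. (\<lambda>s\<in>S. THE a. (a, s) \<in> (\<lambda>s. (g s, s)) ` S) = g"
    proof
      fix g assume g: "g \<in> S \<rightarrow>\<^sub>E A"
      have "(THE a. (a, s) \<in> (\<lambda>s. (g s, s)) ` S) = g s" if "s \<in> S" for s
        using that by (intro the_equality) auto
      then show "(\<lambda>s\<in>S. THE a. (a, s) \<in> (\<lambda>s. (g s, s)) ` S) = g"
        using g by (auto simp: fun_eq_iff PiE_def extensional_def)
    qed
    have the: "(THE a. (a, s) \<in> D, s) \<in> D" if "D \<in> arrows A S" "s \<in> S" for D s
      using that theI'[of "\<lambda>a. (a, s) \<in> D"] by (auto simp: arrows_def)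
    show "\<forall>D\<in>arrows A S. (\<lambda>s. ((\<lambda>s\<in>S. THE a. (a, s) \<in> D) s, s)) ` S = D"
    proof
      fix D assume D: "D \<in> arrows A S"
      have "(a, s) \<in> (\<lambda>s. (THE a. (a, s) \<in> D, s)) ` S" if "(a, s) \<in> D" for a s
      proof -
        have s: "s \<in> S" using that D by (auto simp: arrows_def)
        then have "(THE a. (a, s) \<in> D) = a" using that the[OF D s] D by (auto simp: arrows_def)
        then show ?thesis using s by force
      qed
      moreover have "(\<lambda>s. (THE a. (a, s) \<in> D, s)) ` S \<subseteq> D" using the[OF D] by blast
      ultimately have "(\<lambda>s. (THE a. (a, s) \<in> D, s)) ` S = D" by auto
      then show "(\<lambda>s. ((\<lambda>s\<in>S. THE a. (a, s) \<in> D) s, s)) ` S = D" by simp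
    qed
    show "(\<lambda>g. (\<lambda>s. (g s, s)) ` S) ` (S \<rightarrow>\<^sub>E A) \<subseteq> arrows A S"
      by (auto simp: arrows_def)
    show "(\<lambda>D. \<lambda>s\<in>S. THE a. (a, s) \<in> D) ` arrows A S \<subseteq> S \<rightarrow>\<^sub>E A"
    proof clarify
      fix D assume D: "D \<in> arrows A S"
      have "(THE a. (a, s) \<in> D) \<in> A" if "s \<in> S" for s
        using the[OF D that] D by (auto simp: arrows_def)
      then show "(\<lambda>s\<in>S. THE a. (a, s) \<in> D) \<in> S \<rightarrow>\<^sub>E A" by auto
    qed
  qed
  then have "card (arrows A S) = card (S \<rightarrow>\<^sub>E A)" by (simp add: bij_betw_same_card)
  then show ?thesis using assms by (simp add: card_PiE)
qed

text \<open>\<open>A\<close> is the set of roots and \<open>V\<close> that of the other vertices.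
  With unique parents and \<open>A\<close> disjoint from \<open>V\<close>, reachability from
  \<open>A\<close> excludes cycles.\<close>

definition forests :: "'a set \<Rightarrow> 'a set \<Rightarrow> ('a \<times> 'a) set set" where
  "forests A V = {E. E \<subseteq> (A \<union> V) \<times> V \<and> (\<forall>v\<in>V. \<exists>!u. (u, v) \<in> E) \<and>
     (\<forall>v\<in>V. \<exists>a\<in>A. (a, v) \<in> E\<^sup>*)}"

lemma finite_forests: "finite A \<Longrightarrow> finite V \<Longrightarrow> finite (forests A V)"
  by (rule finite_subset[of _ "Pow ((A \<union> V) \<times> V)"]) (auto simp: forests_def)

lemma forests_attach:
  assumes S: "S \<subseteq> V" and D: "D \<in> arrows A S" and E: "E \<in> forests S (V - S)"
  shows "D \<union> E \<in> forests A V"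
proof -
  have "\<exists>!u. (u, v) \<in> D \<union> E" if v: "v \<in> V" for v
  proof (cases "v \<in> S")
    case True
    then have "(u, v) \<notin> E" for u using E by (auto simp: forests_def)
    moreover have "\<exists>!u. (u, v) \<in> D" using D True by (simp add: arrows_def)
    ultimately show ?thesis by simp
  next
    case False
    then have "(u, v) \<notin> D" for u using D by (auto simp: arrows_def)
    moreover have "\<exists>!u. (u, v) \<in> E" using E False v by (simp add: forests_def)
    ultimately show ?thesis by simp
  qed
  moreover have "\<exists>a\<in>A. (a, v) \<in> (D \<union> E)\<^sup>*" if v: "v \<in> V" for v
  proof -
    have S': "\<exists>a\<in>A. (a, s) \<in> (D \<union> E)\<^sup>*" if s: "s \<in> S" for s
    proof -
      obtain a where "(a, s) \<in> D" using D s unfolding arrows_def by blast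
      moreover then have "a \<in> A" using D by (auto simp: arrows_def)
      ultimately show ?thesis by blast
    qed
    show ?thesis
    proof (cases "v \<in> S")
      case False
      then obtain s where s: "s \<in> S" "(s, v) \<in> E\<^sup>*" using E v unfolding forests_def by blast
      then have "(s, v) \<in> (D \<union> E)\<^sup>*" by (meson Un_upper2 in_mono rtrancl_mono)
      then show ?thesis using S'[OF s(1)] by (meson rtrancl_trans)
    qed (use S' in blast)
  qed
  moreover have "D \<union> E \<subseteq> (A \<union> V) \<times> V" using S D E by (auto simp: arrows_def forests_def)
  ultimately show ?thesis by (simp add: forests_def)
qed

text \<open>Inverse to \<open>forests_attach\<close>. Along a path from a root, an edge that leaves
  \<open>A\<close> ends in a child of \<open>A\<close>, where the path can be restarted; every other
  edge survives the peeling.\<close>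

lemma forests_peel:
  assumes AV: "A \<inter> V = {}" and E: "E \<in> forests A V"
  shows "E \<inter> A \<times> V \<in> arrows A (E `` A)" "E - A \<times> V \<in> forests (E `` A) (V - E `` A)"
proof -
  have sub: "E \<subseteq> (A \<union> V) \<times> V" and ex1: "\<And>v. v \<in> V \<Longrightarrow> \<exists>!u. (u, v) \<in> E"
    and reach: "\<And>v. v \<in> V \<Longrightarrow> \<exists>a\<in>A. (a, v) \<in> E\<^sup>*"
    using E by (auto simp: forests_def)
  have uniq: "u = u'" if "(u, v) \<in> E" "(u', v) \<in> E" for u u' v
    using that ex1[of v] sub by blast
  show "E \<inter> A \<times> V \<in> arrows A (E `` A)"
    using sub uniq unfolding arrows_def by blast
  let ?E = "E - A \<times> V"
  have "\<exists>!u. (u, v) \<in> ?E" if v: "v \<in> V - E `` A" for v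
  proof -
    obtain u where "(u, v) \<in> E" using ex1 v by blast
    moreover then have "u \<notin> A" using v by blast
    ultimately show ?thesis using uniq by blast
  qed
  moreover have "\<exists>s\<in>E `` A. (s, v) \<in> ?E\<^sup>*" if v: "v \<in> V - E `` A" for v
  proof -
    obtain a where a: "a \<in> A" "(a, v) \<in> E\<^sup>*" using reach v by blast
    from a(2) have "v = a \<or> (\<exists>s\<in>E `` A. (s, v) \<in> ?E\<^sup>*)"
    proof (induction rule: rtrancl_induct)
      case (step y z)
      show ?case
      proof (cases "y \<in> A")
        case True
        then show ?thesis using step.hyps by blast
      next
        case False
        then have "(y, z) \<in> ?E" using step.hyps by blast
        then show ?thesis using step.IH False a by (meson rtrancl.rtrancl_into_rtrancl)
      qed
    qed simp
    then show ?thesis using AV a v by blast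
  qed
  \<comment> \<open>An edge of \<open>?E\<close> ending in a child of \<open>A\<close> would give
    that child a second parent.\<close>
  moreover have "?E \<subseteq> (E `` A \<union> (V - E `` A)) \<times> (V - E `` A)"
    using sub uniq by blast
  ultimately show "?E \<in> forests (E `` A) (V - E `` A)" by (simp add: forests_def)
qed

text \<open>Removing the vertices of \<open>A\<close> leaves a forest whose roots are the children of \<open>A\<close>: the
  recursion of \<open>park_funs_rec\<close>.\<close>

lemma forests_rec:
  assumes fin: "finite A" "finite V" and AV: "A \<inter> V = {}"
  shows "card (forests A V) = (\<Sum>S\<in>Pow V. card A ^ card S * card (forests S (V - S)))"
proof -
  let ?X = "SIGMA S:Pow V. arrows A S \<times> forests S (V - S)"
  have "bij_betw (\<lambda>(S, D, E). D \<union> E) ?X (forests A V)"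
  proof (rule bij_betw_byWitness[where f' = "\<lambda>E. (E `` A, E \<inter> A \<times> V, E - A \<times> V)"])
    show "\<forall>x\<in>?X. (\<lambda>E. (E `` A, E \<inter> A \<times> V, E - A \<times> V)) ((\<lambda>(S, D, E). D \<union> E) x) = x"
    proof (clarify, goal_cases)
      case (1 S D E)
      then have sub: "D \<subseteq> A \<times> S" "E \<subseteq> V \<times> (V - S)" and "\<forall>s\<in>S. \<exists>a. (a, s) \<in> D"
        by (auto simp: arrows_def forests_def)
      then have "(D \<union> E) `` A = S" using AV by fast
      moreover have "(D \<union> E) \<inter> A \<times> V = D" "(D \<union> E) - A \<times> V = E"
        using sub AV 1(1) by auto
      ultimately show ?case by simp
    qed
    show "(\<lambda>(S, D, E). D \<union> E) ` ?X \<subseteq> forests A V"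
      using forests_attach by auto
    show "(\<lambda>E. (E `` A, E \<inter> A \<times> V, E - A \<times> V)) ` forests A V \<subseteq> ?X"
    proof (rule image_subsetI)
      fix E assume E: "E \<in> forests A V"
      have "E `` A \<in> Pow V" using E by (auto simp: forests_def)
      then show "(E `` A, E \<inter> A \<times> V, E - A \<times> V) \<in> ?X"
        using forests_peel[OF AV E] by blast
    qed
  qed auto
  then have "card (forests A V) = card ?X" by (simp add: bij_betw_same_card)
  also have "\<dots> = (\<Sum>S\<in>Pow V. card (arrows A S \<times> forests S (V - S)))"
  proof (rule card_SigmaI)
    have "finite (arrows A S)" if "S \<subseteq> V" for S
      by (rule finite_subset[of _ "Pow (A \<times> V)"]) (use that fin in \<open>auto simp: arrows_def\<close>)
    then show "\<forall>S\<in>Pow V. finite (arrows A S \<times> forests S (V - S))"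
      using fin by (auto intro!: finite_forests dest: finite_subset)
  qed (use fin in simp)
  also have "\<dots> = (\<Sum>S\<in>Pow V. card A ^ card S * card (forests S (V - S)))"
    using fin by (intro sum.cong) (auto simp: card_cartesian_product card_arrows finite_subset)
  finally show ?thesis .
qed

lemma card_forests:
  assumes "finite V" "finite A" "A \<inter> V = {}"
  shows "card (forests A V) = abel_count (card A) (card V)"
  using assms
proof (induction V arbitrary: A rule: finite_psubset_induct)
  case (psubset V)
  show ?case
  proof (cases "V = {}")
    case True
    then have "forests A V = {{}}" by (auto simp: forests_def)
    then show ?thesis using True by (simp add: abel_count_def)
  next
    case False
    have "card (forests S (V - S)) = abel_count (card S) (card (V - S))" if "S \<in> Pow V" for S
    \<comment> \<open>Nothing can be reached from an empty set of roots, so the case outside the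
      induction hypothesis contributes 0.\<close>
    proof (cases "S = {}")
      case True
      then have "forests S (V - S) = {}" using False by (auto simp: forests_def)
      then show ?thesis
        using True False psubset.hyps by (simp add: abel_count_0 card_gt_0_iff)
    next
      case S: False
      then show ?thesis using that psubset.hyps by (intro psubset.IH) (auto dest: finite_subset)
    qed
    then show ?thesis
      unfolding forests_rec[OF psubset.prems(1) psubset.hyps psubset.prems(2)]
      by (simp add: abel_count_rec_Pow[OF psubset.hyps])
  qed
qed

section \<open>Trees whose root is smaller than its children\<close>

lemma rooted_tree_iff_forests:
  "rooted_tree V r E \<longleftrightarrow> r \<in> V \<and> E \<in> forests {r} (V - {r})"
proof
  show "r \<in> V \<and> E \<in> forests {r} (V - {r})" if "rooted_tree V r E"
    using that unfolding rooted_tree_def forests_def by auto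
  show "rooted_tree V r E" if "r \<in> V \<and> E \<in> forests {r} (V - {r})"
    using that unfolding rooted_tree_def forests_def by auto
qed

lemma rooted_tree_Range: "rooted_tree V r E \<Longrightarrow> Range E = V - {r}"
  unfolding rooted_tree_def by blast

text \<open>Edge sets alone represent these trees: the root is the only vertex outside
  \<open>Range E\<close>.\<close>

definition min_trees :: "nat set \<Rightarrow> (nat \<times> nat) set set" where
  "min_trees V = {E. \<exists>r. rooted_tree V r E \<and> (\<forall>v. (r, v) \<in> E \<longrightarrow> r < v)}"

text \<open>A tree whose root is smaller than its children is determined by the set \<open>S\<close> formed by the root
  and its children, whose least element is the root, and by the forest hanging from the children.\<close>

lemma card_min_trees:
  assumes fin: "finite V" and ne: "V \<noteq> {}"
  shows "card (min_trees V) = (card V - 1) ^ (card V - 1)"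
proof -
  let ?X = "SIGMA S:Pow V - {{}}. forests (S - {Min S}) (V - S)"
  let ?h = "\<lambda>(S, E). {Min S} \<times> (S - {Min S}) \<union> E"
  define root where "root E = (THE r. r \<in> V - Range E)" for E :: "(nat \<times> nat) set"
  let ?k = "\<lambda>E. (insert (root E) (E `` {root E}), E - {root E} \<times> V)"
  have root: "root E = r" if "rooted_tree V r E" for r E
    unfolding root_def using that rooted_tree_Range[OF that]
    by (intro the_equality) (auto simp: rooted_tree_def)
  have h: "rooted_tree V (Min S) (?h (S, E))" "?h (S, E) `` {Min S} = S - {Min S}"
    "?h (S, E) - {Min S} \<times> V = E"
    if S: "S \<subseteq> V" "S \<noteq> {}" and E: "E \<in> forests (S - {Min S}) (V - S)" for S E
  proof -
    have m: "Min S \<in> S" using S fin by (meson Min_in finite_subset)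
    have eq: "V - S = V - {Min S} - (S - {Min S})" using m by blast
    have "?h (S, E) \<in> forests {Min S} (V - {Min S})"
      unfolding split
    proof (rule forests_attach)
      show "{Min S} \<times> (S - {Min S}) \<in> arrows {Min S} (S - {Min S})" by (auto simp: arrows_def)
    qed (use S E in \<open>auto simp: eq[symmetric]\<close>)
    then show "rooted_tree V (Min S) (?h (S, E))" using m S by (auto simp: rooted_tree_iff_forests)
    \<comment> \<open>No edge of \<open>E\<close> starts at \<open>Min S\<close>, so its children in
      the union are exactly \<open>S - {Min S}\<close>, and \<open>S\<close> can be read
      off.\<close>
    have "Min S \<notin> Domain E" using E m by (auto simp: forests_def)
    then show "?h (S, E) `` {Min S} = S - {Min S}" "?h (S, E) - {Min S} \<times> V = E"
      using S by auto
  qed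
  have "bij_betw ?h ?X (min_trees V)"
  proof (rule bij_betw_byWitness[where f' = ?k])
    show "\<forall>x\<in>?X. ?k (?h x) = x"
    proof
      fix x assume "x \<in> ?X"
      then obtain S E where x: "x = (S, E)" and *: "S \<subseteq> V" "S \<noteq> {}" "E \<in> forests (S - {Min S}) (V - S)"
        by auto
      have m: "Min S \<in> S" using * fin by (meson Min_in finite_subset)
      have r: "root (?h (S, E)) = Min S" by (rule root[OF h(1)[OF *]])
      show "?k (?h x) = x" unfolding x r h(2,3)[OF *] using m by auto
    qed
    have k: "root E \<in> V" "insert (root E) (E `` {root E}) \<subseteq> V" "Min (insert (root E) (E `` {root E})) = root E"
      "E - {root E} \<times> V \<in> forests (E `` {root E}) (V - insert (root E) (E `` {root E}))"
      "root E \<notin> E `` {root E}" "E \<subseteq> V \<times> V"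
      if E: "E \<in> min_trees V" for E
    proof -
      obtain r where r: "rooted_tree V r E" "\<forall>v. (r, v) \<in> E \<longrightarrow> r < v" using E by (auto simp: min_trees_def)
      have rt: "root E = r" by (rule root[OF r(1)])
      show "root E \<in> V" "E \<subseteq> V \<times> V" using r rt by (auto simp: rooted_tree_def)
      show sub: "insert (root E) (E `` {root E}) \<subseteq> V" using r rt by (auto simp: rooted_tree_def)
      show "root E \<notin> E `` {root E}" using r rt by auto
      show "Min (insert (root E) (E `` {root E})) = root E"
        using sub fin r rt by (intro Min_eqI) (auto dest: finite_subset less_imp_le)
      have "E \<in> forests {r} (V - {r})" using r by (simp add: rooted_tree_iff_forests)
      from forests_peel(2)[OF _ this]
      have "E - {r} \<times> (V - {r}) \<in> forests (E `` {r}) (V - {r} - E `` {r})" by blast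
      moreover have "E - {r} \<times> (V - {r}) = E - {r} \<times> V" "V - {r} - E `` {r} = V - insert r (E `` {r})"
        using r by (auto simp: rooted_tree_def)
      ultimately show "E - {root E} \<times> V \<in> forests (E `` {root E}) (V - insert (root E) (E `` {root E}))"
        using rt by simp
    qed
    show "\<forall>E\<in>min_trees V. ?h (?k E) = E"
    proof
      fix E assume E: "E \<in> min_trees V"
      show "?h (?k E) = E" unfolding split k(3)[OF E] using k(1,5,6)[OF E] by auto
    qed
    show "?k ` min_trees V \<subseteq> ?X"
    proof (rule image_subsetI)
      fix E assume E: "E \<in> min_trees V"
      have "insert (root E) (E `` {root E}) - {root E} = E `` {root E}" using k(5)[OF E] by blast
      then show "?k E \<in> ?X" using k[OF E] by auto
    qed
    show "?h ` ?X \<subseteq> min_trees V"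
    proof
      fix y assume "y \<in> ?h ` ?X"
      then obtain S E where y: "y = ?h (S, E)" and *: "S \<subseteq> V" "S \<noteq> {}" "E \<in> forests (S - {Min S}) (V - S)"
        by auto
      have "Min S < v" if "(Min S, v) \<in> y" for v
      proof -
        have "v \<in> S - {Min S}" using that h(2)[OF *] y by blast
        moreover have "finite S" using * fin finite_subset by blast
        ultimately show ?thesis by (simp add: order_le_neq_trans[OF Min_le])
      qed
      then show "y \<in> min_trees V" using h(1)[OF *] y unfolding min_trees_def by blast
    qed
  qed
  then have "card (min_trees V) = card ?X" by (simp add: bij_betw_same_card)
  also have "\<dots> = (\<Sum>S\<in>Pow V - {{}}. card (forests (S - {Min S}) (V - S)))"
    using fin by (intro card_SigmaI) (auto intro!: finite_forests dest: finite_subset)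
  also have "\<dots> = (\<Sum>S\<in>Pow V - {{}}. abel_count (card S - 1) (card (V - S)))"
  proof (rule sum.cong)
    fix S assume S: "S \<in> Pow V - {{}}"
    then have fS: "finite S" using fin finite_subset by auto
    then have "Min S \<in> S" using S by auto
    then show "card (forests (S - {Min S}) (V - S)) = abel_count (card S - 1) (card (V - S))"
      using fS fin by (subst card_forests) auto
  qed simp
  also have "\<dots> = (card V - 1) ^ (card V - 1)" by (rule sum_abel_count_Pow[OF fin ne])
  finally show ?thesis .
qed

section \<open>Forests of such trees and set partitions\<close>

definition min_forests :: "nat set \<Rightarrow> (nat \<times> nat) set set" where
  "min_forests V = {E. E \<in> forests (V - Range E) (V \<inter> Range E) \<and>
     (\<forall>u v. (u, v) \<in> E \<longrightarrow> u \<notin> Range E \<longrightarrow> u < v)}"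

lemma min_forestsD:
  assumes "E \<in> min_forests V"
  shows "E \<subseteq> V \<times> V" "\<And>u u' v. (u, v) \<in> E \<Longrightarrow> (u', v) \<in> E \<Longrightarrow> u = u'"
    "\<And>v. v \<in> V \<Longrightarrow> \<exists>r\<in>V - Range E. (r, v) \<in> E\<^sup>*"
    "\<And>u v. (u, v) \<in> E \<Longrightarrow> u \<notin> Range E \<Longrightarrow> u < v"
proof -
  have E: "E \<subseteq> (V - Range E \<union> V \<inter> Range E) \<times> (V \<inter> Range E)"
    "\<And>v. v \<in> V \<inter> Range E \<Longrightarrow> \<exists>!u. (u, v) \<in> E"
    "\<And>v. v \<in> V \<inter> Range E \<Longrightarrow> \<exists>r\<in>V - Range E. (r, v) \<in> E\<^sup>*"
    "\<And>u v. (u, v) \<in> E \<Longrightarrow> u \<notin> Range E \<Longrightarrow> u < v"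
    using assms unfolding min_forests_def forests_def by auto
  show "E \<subseteq> V \<times> V" "\<And>u v. (u, v) \<in> E \<Longrightarrow> u \<notin> Range E \<Longrightarrow> u < v" using E by blast+
  show "u = u'" if "(u, v) \<in> E" "(u', v) \<in> E" for u u' v
    using that E(1) E(2)[of v] by blast
  show "\<exists>r\<in>V - Range E. (r, v) \<in> E\<^sup>*" if "v \<in> V" for v
    using E(3)[of v] that by (cases "v \<in> Range E") auto
qed

lemma min_forestsI:
  assumes "E \<subseteq> V \<times> V" "\<And>u u' v. (u, v) \<in> E \<Longrightarrow> (u', v) \<in> E \<Longrightarrow> u = u'"
    "\<And>v. v \<in> V \<Longrightarrow> \<exists>r\<in>V - Range E. (r, v) \<in> E\<^sup>*"
    "\<And>u v. (u, v) \<in> E \<Longrightarrow> u \<notin> Range E \<Longrightarrow> u < v"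
  shows "E \<in> min_forests V"
proof -
  have "\<exists>!u. (u, v) \<in> E" if "v \<in> Range E" for v using assms(2) that by blast
  moreover have "E \<subseteq> (V - Range E \<union> V \<inter> Range E) \<times> (V \<inter> Range E)" using assms(1) by blast
  ultimately show ?thesis using assms(3,4) unfolding min_forests_def forests_def by auto
qed

text \<open>Unique parents make two paths into \<open>v\<close> agree backwards edge by edge, and
  neither can stop before the other because a root has no incoming edge.\<close>

lemma root_unique:
  assumes "(r, v) \<in> E\<^sup>*" "(r', v) \<in> E\<^sup>*" "r \<notin> Range E" "r' \<notin> Range E"
    and uniq: "\<And>u u' v. (u, v) \<in> E \<Longrightarrow> (u', v) \<in> E \<Longrightarrow> u = u'"
  shows "r = r'"
  using assms(1,2)
proof (induction rule: rtrancl_induct)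
  case base
  then show ?case using assms(3) by (metis RangeI rtranclE)
next
  case (step y z)
  then show ?case using assms(4) uniq by (metis RangeI rtranclE)
qed

text \<open>The sets of vertices reachable from the single roots are the blocks, and the edges
  inside a block form its tree. Conversely the trees chosen on the blocks are united.\<close>

lemma card_min_forests:
  assumes fin: "finite V"
  shows "card (min_forests V) = (\<Sum>P | partition_on V P. \<Prod>Q\<in>P. (card Q - 1) ^ (card Q - 1))"
proof -
  let ?X = "SIGMA P:{P. partition_on V P}. PiE P min_trees"
  let ?h = "\<lambda>(P, g). \<Union>Q\<in>P. g Q :: (nat \<times> nat) set"
  let ?P = "\<lambda>E. (\<lambda>r. E\<^sup>* `` {r}) ` (V - Range E)"
  let ?k = "\<lambda>E. (?P E, \<lambda>Q\<in>?P E. E \<inter> Q \<times> Q)"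
  have h: "?h (P, g) \<in> min_forests V" "?k (?h (P, g)) = (P, g)"
    if P: "partition_on V P" and g: "g \<in> PiE P min_trees" for P g
  proof -
    define E where "E = (\<Union>Q\<in>P. g Q)"
    have "\<forall>Q\<in>P. \<exists>r. rooted_tree Q r (g Q) \<and> (\<forall>v. (r, v) \<in> g Q \<longrightarrow> r < v)"
      using g by (auto simp: PiE_iff min_trees_def)
    then obtain root where root: "\<And>Q. Q \<in> P \<Longrightarrow> rooted_tree Q (root Q) (g Q)"
      "\<And>Q v. Q \<in> P \<Longrightarrow> (root Q, v) \<in> g Q \<Longrightarrow> root Q < v" by metis
    have gQ: "g Q \<subseteq> Q \<times> Q" if "Q \<in> P" for Q using root(1)[OF that] by (simp add: rooted_tree_def)
    have rQ: "root Q \<in> Q" if "Q \<in> P" for Q using root(1)[OF that] by (simp add: rooted_tree_def)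
    have reQ: "(root Q, v) \<in> (g Q)\<^sup>*" if "Q \<in> P" "v \<in> Q" for Q v
      using root(1)[OF that(1)] that by (simp add: rooted_tree_def)
    have uQ: "u = u'" if "Q \<in> P" "(u, v) \<in> g Q" "(u', v) \<in> g Q" for Q u u' v
      using root(1)[OF that(1)] that gQ[OF that(1)] unfolding rooted_tree_def by blast
    have dis: "Q = Q'" if "Q \<in> P" "Q' \<in> P" "x \<in> Q" "x \<in> Q'" for Q Q' x
      using P that by (metis IntI disjointD empty_iff partition_onD2)
    have UP: "\<Union>P = V" using P by (simp add: partition_on_def)
    \<comment> \<open>An edge touching \<open>Q\<close> belongs to the tree of \<open>Q\<close>,
      since each tree stays in its block and the blocks are disjoint.\<close>
    have in_g: "(u, v) \<in> g Q" if "(u, v) \<in> E" "Q \<in> P" "u \<in> Q \<or> v \<in> Q" for u v Q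
    proof -
      obtain Q' where Q': "Q' \<in> P" "(u, v) \<in> g Q'" using \<open>(u, v) \<in> E\<close> by (auto simp: E_def)
      then have "u \<in> Q'" "v \<in> Q'" using gQ by blast+
      then have "Q' = Q" using dis Q' that by blast
      then show ?thesis using Q' by simp
    qed
    have gE: "g Q \<subseteq> E" if "Q \<in> P" for Q using that by (auto simp: E_def)
    have EQ: "E \<inter> Q \<times> Q = g Q" if "Q \<in> P" for Q
      using in_g[OF _ that] gE[OF that] gQ[OF that] by auto
    have rootR: "v \<in> Range E \<longleftrightarrow> v \<noteq> root Q" if "Q \<in> P" "v \<in> Q" for v Q
    proof -
      have "v \<in> Range E \<longleftrightarrow> v \<in> Range (g Q)" using in_g gE that by blast
      then show ?thesis using rooted_tree_Range[OF root(1)[OF that(1)]] that by simp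
    qed
    have roots: "V - Range E = root ` P"
      using rootR rQ unfolding UP[symmetric] by auto
    have cls: "E\<^sup>* `` {root Q} = Q" if "Q \<in> P" for Q
    proof
      show "Q \<subseteq> E\<^sup>* `` {root Q}"
        using reQ[OF that] rtrancl_mono[OF gE[OF that]] by blast
      have "v \<in> Q" if "(root Q, v) \<in> E\<^sup>*" for v
        using that
      proof (induction rule: rtrancl_induct)
        case base
        show ?case using rQ[OF \<open>Q \<in> P\<close>] .
      next
        case (step y z)
        then show ?case using in_g[OF _ \<open>Q \<in> P\<close>] gQ[OF \<open>Q \<in> P\<close>] by blast
      qed
      then show "E\<^sup>* `` {root Q} \<subseteq> Q" by blast
    qed
    have PE: "?P E = P" unfolding roots using cls by (simp add: image_image)
    have "(\<lambda>Q\<in>P. E \<inter> Q \<times> Q) = g"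
      using g EQ by (auto simp: fun_eq_iff PiE_def extensional_def restrict_def)
    then show "?k (?h (P, g)) = (P, g)" unfolding split E_def[symmetric] PE by simp
    have "E \<in> min_forests V"
    proof (rule min_forestsI)
      show "E \<subseteq> V \<times> V" using gQ UP unfolding E_def by blast
      show "u = u'" if e: "(u, v) \<in> E" "(u', v) \<in> E" for u u' v
      proof -
        obtain Q where "Q \<in> P" "(u, v) \<in> g Q" using e by (auto simp: E_def)
        moreover then have "v \<in> Q" using gQ by blast
        ultimately show ?thesis using in_g[OF e(2)] uQ by blast
      qed
      show "\<exists>r\<in>V - Range E. (r, v) \<in> E\<^sup>*" if "v \<in> V" for v
        unfolding roots using that cls UP by blast
      show "u < v" if e: "(u, v) \<in> E" "u \<notin> Range E" for u v
      proof -
        obtain Q where Q: "Q \<in> P" "(u, v) \<in> g Q" using e by (auto simp: E_def)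
        then have "u = root Q" using rootR[OF Q(1), of u] gQ[OF Q(1)] e by blast
        then show ?thesis using root(2) Q by blast
      qed
    qed
    then show "?h (P, g) \<in> min_forests V" by (simp add: E_def)
  qed
  have k: "?k E \<in> ?X" "?h (?k E) = E" if E: "E \<in> min_forests V" for E
  proof -
    note D = min_forestsD[OF E]
    have inV: "v \<in> V" if "(r, v) \<in> E\<^sup>*" "r \<in> V" for r v
      using that D(1) by (induction rule: rtrancl_induct) auto
    have "partition_on V (?P E)"
      unfolding partition_on_def
    proof (intro conjI)
      show "\<Union>(?P E) = V" using D(3) inV by blast
      show "disjoint (?P E)"
      proof (rule disjointI)
        fix Q Q' assume "Q \<in> ?P E" "Q' \<in> ?P E" and QQ': "Q \<noteq> Q'"
        then obtain r r' where r: "r \<notin> Range E" "r' \<notin> Range E" and Q: "Q = E\<^sup>* `` {r}" "Q' = E\<^sup>* `` {r'}"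
          by blast
        have "r = r'" if "v \<in> Q" "v \<in> Q'" for v
          by (rule root_unique[of r v E r']) (use that Q r D(2) in auto)
        then show "Q \<inter> Q' = {}" using Q QQ' by blast
      qed
      show "{} \<notin> ?P E" by blast
    qed
    moreover have "E \<inter> Q \<times> Q \<in> min_trees Q" if QP: "Q \<in> ?P E" for Q
    proof -
      obtain r where r: "r \<in> V" "r \<notin> Range E" and Q: "Q = E\<^sup>* `` {r}" using QP by blast
      have "rooted_tree Q r (E \<inter> Q \<times> Q)"
        unfolding rooted_tree_def
      proof (intro conjI ballI allI)
        show "r \<in> Q" by (simp add: Q)
        show "(u, r) \<notin> E \<inter> Q \<times> Q" for u using r by blast
        show "\<exists>!u. (u, v) \<in> E \<inter> Q \<times> Q" if v: "v \<in> Q - {r}" for v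
        proof -
          obtain x where "(r, x) \<in> E\<^sup>*" "(x, v) \<in> E" using v unfolding Q by (auto elim: rtranclE)
          then have "(x, v) \<in> E \<inter> Q \<times> Q" using v Q by blast
          then show ?thesis using D(2) by blast
        qed
        show "(r, v) \<in> (E \<inter> Q \<times> Q)\<^sup>*" if "v \<in> Q" for v
        proof -
          have "(r, v) \<in> E\<^sup>*" using that Q by blast
          then show ?thesis
          proof (induction rule: rtrancl_induct)
            case (step y z)
            then have "(y, z) \<in> E \<inter> Q \<times> Q" unfolding Q by (auto intro: rtrancl_into_rtrancl)
            then show ?case using step.IH by (rule rtrancl_into_rtrancl[rotated])
          qed simp
        qed
      qed blast
      moreover have "r < v" if "(r, v) \<in> E \<inter> Q \<times> Q" for v using D(4) r that by blast
      ultimately show ?thesis unfolding min_trees_def by blast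
    qed
    ultimately show "?k E \<in> ?X" by auto
    have "e \<in> (\<Union>Q\<in>?P E. E \<inter> Q \<times> Q)" if "e \<in> E" for e
    proof -
      obtain u v where e: "e = (u, v)" by (cases e)
      then have "u \<in> V" using D(1) that by blast
      then obtain r where r: "r \<in> V - Range E" "(r, u) \<in> E\<^sup>*" using D(3) by blast
      moreover then have "(r, v) \<in> E\<^sup>*" using that e by (auto intro: rtrancl_into_rtrancl)
      ultimately show ?thesis using that e by blast
    qed
    then have "(\<Union>Q\<in>?P E. E \<inter> Q \<times> Q) = E" by blast
    then show "?h (?k E) = E" by simp
  qed
  have "bij_betw ?h ?X (min_forests V)"
  proof (rule bij_betw_byWitness[where f' = ?k])
    show "\<forall>x\<in>?X. ?k (?h x) = x"
    proof
      fix x assume "x \<in> ?X"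
      then obtain P g where "x = (P, g)" "partition_on V P" "g \<in> PiE P min_trees" by auto
      then show "?k (?h x) = x" using h(2)[of P g] by (simp only:)
    qed
    show "\<forall>E\<in>min_forests V. ?h (?k E) = E" by (rule ballI) (rule k(2))
    show "?h ` ?X \<subseteq> min_forests V"
    proof (rule image_subsetI)
      fix x assume "x \<in> ?X"
      then obtain P g where "x = (P, g)" "partition_on V P" "g \<in> PiE P min_trees" by auto
      then show "?h x \<in> min_forests V" using h(1)[of P g] by simp
    qed
    show "?k ` min_forests V \<subseteq> ?X" by (rule image_subsetI) (rule k(1))
  qed
  then have "card (min_forests V) = card ?X" by (simp add: bij_betw_same_card)
  also have "\<dots> = (\<Sum>P | partition_on V P. card (PiE P min_trees))"
  proof (rule card_SigmaI)
    show "finite {P. partition_on V P}" using fin by (rule finitely_many_partition_on)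
    have "finite (min_trees Q)" if "finite Q" for Q
      by (rule finite_subset[of _ "Pow (Q \<times> Q)"]) (use that in \<open>auto simp: min_trees_def rooted_tree_def\<close>)
    moreover have "finite Q" if "partition_on V P" "Q \<in> P" for P Q
      using that fin by (auto simp: partition_on_def intro: finite_subset)
    ultimately show "\<forall>P\<in>{P. partition_on V P}. finite (PiE P min_trees)"
      using finite_elements[OF fin] by (auto intro!: finite_PiE)
  qed
  also have "\<dots> = (\<Sum>P | partition_on V P. \<Prod>Q\<in>P. (card Q - 1) ^ (card Q - 1))"
  proof (rule sum.cong)
    fix P assume "P \<in> {P. partition_on V P}"
    then have P: "partition_on V P" by simp
    then have "finite P" using fin finite_elements by blast
    moreover have "finite Q" "Q \<noteq> {}" if "Q \<in> P" for Q
      using P that fin by (auto simp: partition_on_def intro: finite_subset)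
    ultimately show "card (PiE P min_trees) = (\<Prod>Q\<in>P. (card Q - 1) ^ (card Q - 1))"
      by (simp add: card_PiE card_min_trees)
  qed simp
  finally show ?thesis .
qed

section \<open>Chain trees\<close>

text \<open>The decreasing path through \<open>R\<close>, written as the covering relation of the
  order so that it depends on the set alone.\<close>

definition links :: "nat set \<Rightarrow> (nat \<times> nat) set" where
  "links R = {(x, y). x \<in> R \<and> y \<in> R \<and> y < x \<and> (\<forall>z\<in>R. \<not> (y < z \<and> z < x))}"

lemma links_set_decreasing:
  assumes "sorted_wrt (>) xs"
  shows "links (set xs) = {(xs ! i, xs ! Suc i) | i. Suc i < length xs}"
proof -
  have less: "xs ! j < xs ! i \<longleftrightarrow> i < j" if "i < length xs" "j < length xs" for i j
    using that assms by (metis linorder_less_linear order_less_imp_not_less sorted_wrt_nth_less)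
  show ?thesis
  proof (intro set_eqI iffI)
    fix e assume "e \<in> links (set xs)"
    then obtain x y where e: "e = (x, y)" and xy: "x \<in> set xs" "y \<in> set xs" "y < x"
      "\<forall>z\<in>set xs. \<not> (y < z \<and> z < x)" by (auto simp: links_def)
    obtain i where i: "i < length xs" "x = xs ! i" using xy by (auto simp: in_set_conv_nth)
    obtain j where j: "j < length xs" "y = xs ! j" using xy by (auto simp: in_set_conv_nth)
    have ij: "i < j" using xy(3) less[OF i(1) j(1)] i j by simp
    have "j = Suc i"
    proof (rule ccontr)
      assume "j \<noteq> Suc i"
      then have *: "Suc i < j" using ij by simp
      then have "xs ! j < xs ! Suc i" "xs ! Suc i < xs ! i"
        using less[of "Suc i" j] less[of i "Suc i"] i j by auto
      moreover have "xs ! Suc i \<in> set xs" using * j by simp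
      ultimately show False using xy(4) i j by blast
    qed
    then show "e \<in> {(xs ! i, xs ! Suc i) | i. Suc i < length xs}" using e i j by blast
  next
    fix e assume "e \<in> {(xs ! i, xs ! Suc i) | i. Suc i < length xs}"
    then obtain i where e: "e = (xs ! i, xs ! Suc i)" and i: "Suc i < length xs" by blast
    have "\<not> (xs ! Suc i < z \<and> z < xs ! i)" if "z \<in> set xs" for z
    proof -
      obtain k where k: "k < length xs" "z = xs ! k" using \<open>z \<in> set xs\<close> by (auto simp: in_set_conv_nth)
      show ?thesis using less[of k "Suc i"] less[of i k] i k by auto
    qed
    then show "e \<in> links (set xs)" using e i less[of i "Suc i"] by (auto simp: links_def)
  qed
qed

lemma hd_decreasing:
  assumes "sorted_wrt (>) (xs :: nat list)" "xs \<noteq> []"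
  shows "hd xs = Max (set xs)"
  using assms by (cases xs) (auto intro!: Max_eqI[symmetric] simp: less_imp_le)

text \<open>The parent of \<open>y\<close> is the least element of \<open>R\<close> above
  \<open>y\<close>; passing from parent to parent ends at \<open>Max R\<close>.\<close>

lemma rooted_tree_links:
  assumes fin: "finite R" and ne: "R \<noteq> {}"
  shows "rooted_tree R (Max R) (links R)"
  unfolding rooted_tree_def
proof (intro conjI ballI allI)
  show "Max R \<in> R" using assms by simp
  show "links R \<subseteq> R \<times> R" by (auto simp: links_def)
  show "(u, Max R) \<notin> links R" for u
    using fin by (auto simp: links_def not_less)
  have parent: "\<exists>!x. (x, y) \<in> links R" if y: "y \<in> R" "y \<noteq> Max R" for y
  proof -
    let ?Z = "{z \<in> R. y < z}"
    have "y < Max R" using y fin by (simp add: order_le_neq_trans)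
    then have "?Z \<noteq> {}" using assms Max_in by blast
    then have m: "Min ?Z \<in> ?Z" using fin Min_in[of ?Z] by simp
    have le: "Min ?Z \<le> z" if "z \<in> R" "y < z" for z using that fin by simp
    have "(Min ?Z, y) \<in> links R" using m le y by (auto simp: links_def not_less[symmetric])
    moreover have "x = Min ?Z" if "(x, y) \<in> links R" for x
    proof -
      have "\<not> Min ?Z < x" using that m by (auto simp: links_def)
      moreover have "Min ?Z \<le> x" using that le by (auto simp: links_def)
      ultimately show ?thesis by simp
    qed
    ultimately show ?thesis by blast
  qed
  then show "\<exists>!x. (x, y) \<in> links R" if "y \<in> R - {Max R}" for y using that by blast
  show "(Max R, y) \<in> (links R)\<^sup>*" if "y \<in> R" for y
    using that
  proof (induction "Max R - y" arbitrary: y rule: less_induct)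
    case less
    show ?case
    proof (cases "y = Max R")
      case False
      then obtain x where x: "(x, y) \<in> links R" using parent less.prems by blast
      then have "x \<in> R" "y < x" by (auto simp: links_def)
      moreover have "x \<le> Max R" using fin \<open>x \<in> R\<close> by simp
      ultimately have "(Max R, x) \<in> (links R)\<^sup>*" by (intro less.hyps) auto
      then show ?thesis using x by (rule rtrancl_into_rtrancl)
    qed simp
  qed
qed

text \<open>Edges of \<open>E\<close> out of a root go up and links stay in \<open>R\<close>, so
  descending edges never leave \<open>R\<close>. This makes \<open>R\<close> maximal, and it also
  recovers \<open>R\<close> from the tree as the set reached from \<open>Max R\<close> by descending
  edges. The last two conclusions thus give a left inverse of the construction.\<close>

lemma min_forest_to_chain_tree:
  assumes fin: "finite V" and ne: "V \<noteq> {}" and E: "E \<in> min_forests V" and R: "R = V - Range E"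
  shows "rooted_tree V (Max R) (E \<union> links R)"
    "max_decreasing_subtree V (Max R) (E \<union> links R) R"
    "chain_from (Max R) (E \<union> links R) R"
    "((E \<union> links R) \<inter> {(x, y). y < x})\<^sup>* `` {Max R} = R"
    "(E \<union> links R) - R \<times> R = E"
proof -
  note D = min_forestsD[OF E]
  have finR: "finite R" using fin R by simp
  have neR: "R \<noteq> {}" using ne D(3) R by blast
  have LR: "links R \<subseteq> R \<times> R" by (auto simp: links_def)
  note L = rooted_tree_links[OF finR neR, unfolded rooted_tree_def]
  have ER: "v \<notin> R" if "(u, v) \<in> E" for u v using that R by blast
  have in_R: "(E \<union> links R) \<inter> R \<times> R = links R" using ER LR by blast
  show "(E \<union> links R) - R \<times> R = E" using ER LR by blast
  show "rooted_tree V (Max R) (E \<union> links R)"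
    unfolding rooted_tree_def
  proof (intro conjI ballI allI)
    show "Max R \<in> V" using L R by blast
    show "E \<union> links R \<subseteq> V \<times> V" using D(1) LR R by blast
    show "(u, Max R) \<notin> E \<union> links R" for u using L ER by blast
    show "\<exists>!u. (u, v) \<in> E \<union> links R" if v: "v \<in> V - {Max R}" for v
    proof (cases "v \<in> R")
      case True
      then have "(u, v) \<notin> E" for u using ER by blast
      then show ?thesis using L True v by simp
    next
      case False
      then have "(u, v) \<notin> links R" for u using LR by blast
      moreover have "v \<in> Range E" using v False R by blast
      ultimately show ?thesis using D(2) by blast
    qed
    show "(Max R, v) \<in> (E \<union> links R)\<^sup>*" if "v \<in> V" for v
    proof -
      obtain r where r: "r \<in> R" "(r, v) \<in> E\<^sup>*" using D(3)[OF \<open>v \<in> V\<close>] R by blast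
      have "(Max R, r) \<in> (links R)\<^sup>*" using L r by blast
      then have "(Max R, r) \<in> (E \<union> links R)\<^sup>*" by (meson Un_upper2 in_mono rtrancl_mono)
      moreover have "(r, v) \<in> (E \<union> links R)\<^sup>*" using r by (meson Un_upper1 in_mono rtrancl_mono)
      ultimately show ?thesis by (rule rtrancl_trans)
    qed
  qed
  have dec: "v \<in> R" if "(u, v) \<in> E \<union> links R" "v < u" "u \<in> R" for u v
    using that D(4)[of u v] LR R by auto
  show "max_decreasing_subtree V (Max R) (E \<union> links R) R"
    unfolding max_decreasing_subtree_def
  proof (intro conjI allI impI)
    show "R \<subseteq> V" using R by blast
    show "decreasing_subtree (Max R) (E \<union> links R) R"
      unfolding decreasing_subtree_def in_R using rooted_tree_links[OF finR neR]
      by (auto simp: links_def)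
    fix S assume "S \<subseteq> V" and S: "decreasing_subtree (Max R) (E \<union> links R) S \<and> R \<subseteq> S"
    have "v \<in> R" if "v \<in> S" for v
    proof -
      let ?E = "(E \<union> links R) \<inter> S \<times> S"
      have "(Max R, v) \<in> ?E\<^sup>*"
        using S that by (simp add: decreasing_subtree_def rooted_tree_def)
      then show ?thesis
      proof (induction rule: rtrancl_induct)
        case base
        show ?case using finR neR by simp
      next
        case (step y z)
        then show ?case using S dec[of y z] unfolding decreasing_subtree_def by blast
      qed
    qed
    then show "S = R" using S by blast
  qed
  show "chain_from (Max R) (E \<union> links R) R"
    unfolding chain_from_def in_R
  proof (intro exI conjI)
    let ?xs = "rev (sorted_list_of_set R)"
    have xs: "sorted_wrt (>) ?xs" "set ?xs = R" using finR by (simp_all add: sorted_wrt_rev)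
    show "?xs \<noteq> []" using finR neR by simp
    then show "hd ?xs = Max R" using hd_decreasing[OF xs(1)] xs(2) by simp
    show "distinct ?xs" by simp
    show "set ?xs = R" by (rule xs(2))
    show "links R = {(?xs ! i, ?xs ! Suc i) | i. Suc i < length ?xs}"
      using links_set_decreasing[OF xs(1)] xs(2) by simp
  qed
  show "((E \<union> links R) \<inter> {(x, y). y < x})\<^sup>* `` {Max R} = R"
  proof
    have "links R \<subseteq> (E \<union> links R) \<inter> {(x, y). y < x}" by (auto simp: links_def)
    then show "R \<subseteq> ((E \<union> links R) \<inter> {(x, y). y < x})\<^sup>* `` {Max R}"
      using L rtrancl_mono by blast
    have "v \<in> R" if "(Max R, v) \<in> ((E \<union> links R) \<inter> {(x, y). y < x})\<^sup>*" for v
      using that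
    proof (induction rule: rtrancl_induct)
      case base
      show ?case using finR neR by simp
    next
      case (step y z)
      then show ?case using dec[of y z] by blast
    qed
    then show "((E \<union> links R) \<inter> {(x, y). y < x})\<^sup>* `` {Max R} \<subseteq> R" by blast
  qed
qed

text \<open>By maximality an edge leaving \<open>S\<close> cannot descend, since its end could be
  added to \<open>S\<close>. The edges of the chain do descend, so its list is decreasing and is
  determined by \<open>S\<close>.\<close>

lemma chain_tree_to_min_forest:
  assumes T: "rooted_tree V r E" and S: "max_decreasing_subtree V r E S"
    and ch: "chain_from r E S"
  shows "E - S \<times> S \<in> min_forests V" "V - Range (E - S \<times> S) = S" "r = Max S" "E \<inter> S \<times> S = links S"
proof -
  have SV: "S \<subseteq> V" and TS: "rooted_tree S r (E \<inter> S \<times> S)"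
    and dec: "\<And>u v. (u, v) \<in> E \<Longrightarrow> u \<in> S \<Longrightarrow> v \<in> S \<Longrightarrow> v < u"
    and maximal: "\<And>S'. S' \<subseteq> V \<Longrightarrow> decreasing_subtree r E S' \<Longrightarrow> S \<subseteq> S' \<Longrightarrow> S' = S"
    using S by (auto simp: max_decreasing_subtree_def decreasing_subtree_def)
  have EV: "E \<subseteq> V \<times> V" and nor: "\<And>u. (u, r) \<notin> E" using T by (auto simp: rooted_tree_def)
  have rS: "r \<in> S" using TS by (simp add: rooted_tree_def)
  have uniq: "u = u'" if "(u, v) \<in> E" "(u', v) \<in> E" for u u' v
    using that T unfolding rooted_tree_def by blast
  have into_S: "u \<in> S" if "(u, v) \<in> E" "v \<in> S" for u v
  proof -
    have "v \<in> S - {r}" using that nor by blast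
    then obtain u' where "(u', v) \<in> E \<inter> S \<times> S" using TS unfolding rooted_tree_def by blast
    then show ?thesis using uniq \<open>(u, v) \<in> E\<close> by blast
  qed
  let ?E = "E - S \<times> S"
  show roots: "V - Range ?E = S"
  proof
    show "S \<subseteq> V - Range ?E" using SV into_S by blast
    show "V - Range ?E \<subseteq> S"
    proof
      fix v assume v: "v \<in> V - Range ?E"
      show "v \<in> S"
      proof (rule ccontr)
        assume "v \<notin> S"
        then have "v \<in> V - {r}" using v rS by blast
        then obtain u where "(u, v) \<in> E" using T unfolding rooted_tree_def by blast
        then show False using v \<open>v \<notin> S\<close> by blast
      qed
    qed
  qed
  show "?E \<in> min_forests V"
  proof (rule min_forestsI)
    show "?E \<subseteq> V \<times> V" using EV by blast
    show "u = u'" if "(u, v) \<in> ?E" "(u', v) \<in> ?E" for u u' v using uniq that by blast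
    show "\<exists>r\<in>V - Range ?E. (r, v) \<in> ?E\<^sup>*" if "v \<in> V" for v
    proof -
      have "(r, v) \<in> E\<^sup>*" using T that by (simp add: rooted_tree_def)
      \<comment> \<open>The path is restarted whenever it meets \<open>S\<close>; an edge ending
        outside \<open>S\<close> is not cut.\<close>
      then have "\<exists>s\<in>S. (s, v) \<in> ?E\<^sup>*"
      proof (induction rule: rtrancl_induct)
        case base
        then show ?case using rS by blast
      next
        case (step y z)
        then show ?case by (cases "z \<in> S") (auto intro: rtrancl_into_rtrancl)
      qed
      then show ?thesis using roots by simp
    qed
    show "u < v" if e: "(u, v) \<in> ?E" "u \<notin> Range ?E" for u v
    proof (rule ccontr)
      assume "\<not> u < v"
      have u: "u \<in> S" using e EV roots by blast
      then have v: "v \<notin> S" using e by blast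
      then have vu: "v < u" using \<open>\<not> u < v\<close> u by (metis linorder_neqE_nat)
      \<comment> \<open>Only the edge \<open>(u, v)\<close> is new: parents are unique, and the
        parent of a vertex of \<open>S\<close> lies in \<open>S\<close>.\<close>
      have E': "E \<inter> insert v S \<times> insert v S = insert (u, v) (E \<inter> S \<times> S)"
        using e u v uniq into_S vu by (auto dest: uniq)
      have "rooted_tree (insert v S) r (insert (u, v) (E \<inter> S \<times> S))"
        unfolding rooted_tree_def
      proof (intro conjI ballI allI)
        show "r \<in> insert v S" using rS by simp
        show "insert (u, v) (E \<inter> S \<times> S) \<subseteq> insert v S \<times> insert v S" using u by blast
        show "(x, r) \<notin> insert (u, v) (E \<inter> S \<times> S)" for x using nor v rS by blast
        show "\<exists>!x. (x, w) \<in> insert (u, v) (E \<inter> S \<times> S)" if w: "w \<in> insert v S - {r}" for w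
        proof (cases "w = v")
          case True
          then show ?thesis using v by blast
        next
          case False
          then have "\<exists>!x. (x, w) \<in> E \<inter> S \<times> S" using TS w unfolding rooted_tree_def by blast
          then show ?thesis using False by simp
        qed
        have reach: "(r, w) \<in> (insert (u, v) (E \<inter> S \<times> S))\<^sup>*" if "w \<in> S" for w
        proof -
          have "(r, w) \<in> (E \<inter> S \<times> S)\<^sup>*" using TS that by (simp add: rooted_tree_def)
          then show ?thesis by (meson in_mono rtrancl_mono subset_insertI)
        qed
        show "(r, w) \<in> (insert (u, v) (E \<inter> S \<times> S))\<^sup>*" if "w \<in> insert v S" for w
          using reach[of w] rtrancl_into_rtrancl[OF reach[OF u], of v] that by blast
      qed
      then have "decreasing_subtree r E (insert v S)"
        unfolding decreasing_subtree_def E' using vu dec by blast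
      moreover have "insert v S \<subseteq> V" using SV EV e by blast
      ultimately have "insert v S = S" using maximal by blast
      then show False using v by blast
    qed
  qed
  obtain xs where xs: "xs \<noteq> []" "hd xs = r" "set xs = S"
    "E \<inter> S \<times> S = {(xs ! i, xs ! Suc i) | i. Suc i < length xs}"
    using ch by (auto simp: chain_from_def)
  have "sorted_wrt (>) xs"
  proof (subst sorted_wrt_iff_nth_Suc_transp)
    show "transp ((>) :: nat \<Rightarrow> nat \<Rightarrow> bool)" by (auto simp: transp_def)
    show "\<forall>i. Suc i < length xs \<longrightarrow> xs ! Suc i < xs ! i"
      using xs(4) dec by blast
  qed
  then show "r = Max S" "E \<inter> S \<times> S = links S"
    using hd_decreasing links_set_decreasing xs by auto
qed

lemma card_chain_trees:
  assumes "n \<ge> 1"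
  shows "card (chain_trees n) = card (min_forests {1..n})"
proof -
  let ?V = "{1..n}"
  let ?f = "\<lambda>E. (Max (?V - Range E), E \<union> links (?V - Range E))"
  have ne: "?V \<noteq> {}" using assms by simp
  note F = min_forest_to_chain_tree[OF finite_atLeastAtMost ne _ refl]
  have "bij_betw ?f (min_forests ?V) (chain_trees n)"
    unfolding bij_betw_def
  proof
    show "inj_on ?f (min_forests ?V)"
    proof (rule inj_on_inverseI)
      fix E assume E: "E \<in> min_forests ?V"
      show "(\<lambda>(r, E). let S = (E \<inter> {(x, y). y < x})\<^sup>* `` {r} in E - S \<times> S) (?f E) = E"
        unfolding split Let_def F(4)[OF E] by (rule F(5)[OF E])
    qed
    show "?f ` min_forests ?V = chain_trees n"
    proof
      show "?f ` min_forests ?V \<subseteq> chain_trees n"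
        unfolding chain_trees_def using F(1-3) by blast
      show "chain_trees n \<subseteq> ?f ` min_forests ?V"
      proof
        fix x assume "x \<in> chain_trees n"
        then obtain r E S where x: "x = (r, E)" and *: "rooted_tree ?V r E"
          "max_decreasing_subtree ?V r E S" "chain_from r E S"
          by (auto simp: chain_trees_def)
        note G = chain_tree_to_min_forest[OF *]
        have "E - S \<times> S \<union> links S = E" unfolding G(4)[symmetric] by blast
        then have "x = ?f (E - S \<times> S)" unfolding G(2) x by (simp add: G(3)[symmetric])
        then show "x \<in> ?f ` min_forests ?V" using G(1) by blast
      qed
    qed
  qed
  then show ?thesis by (simp add: bij_betw_same_card)
qed

section \<open>Words and biwords\<close>

text \<open>This is the list index used in \<open>Phi\<close>; on a finite set it inverts indexing
  into \<open>sorted_list_of_set\<close>.\<close>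

definition rank :: "nat set \<Rightarrow> nat \<Rightarrow> nat" where
  "rank L p = card {x \<in> L. x < p}"

lemma rank_nth_sorted_list:
  assumes "finite L" "t < card L"
  shows "rank L (sorted_list_of_set L ! t) = t"
proof -
  let ?xs = "sorted_list_of_set L"
  have len: "length ?xs = card L" and set: "set ?xs = L" using assms by auto
  have less: "?xs ! i < ?xs ! j \<longleftrightarrow> i < j" if "i < card L" "j < card L" for i j
    using that len by (metis linorder_less_linear order_less_imp_not_less sorted_wrt_nth_less
        strict_sorted_list_of_set)
  have "{x \<in> L. x < ?xs ! t} = (\<lambda>i. ?xs ! i) ` {..<t}"
  proof (intro set_eqI iffI)
    fix x assume x: "x \<in> {x \<in> L. x < ?xs ! t}"
    then obtain i where "i < card L" "x = ?xs ! i" using set len by (metis (no_types, lifting) in_set_conv_nth mem_Collect_eq)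
    then show "x \<in> (\<lambda>i. ?xs ! i) ` {..<t}" using x less assms by auto
  next
    fix x assume "x \<in> (\<lambda>i. ?xs ! i) ` {..<t}"
    then obtain i where i: "i < t" "x = ?xs ! i" by auto
    then have "x \<in> L" using set len assms by (metis nth_mem order.strict_trans)
    then show "x \<in> {x \<in> L. x < ?xs ! t}" using i less[of i t] assms by auto
  qed
  moreover have "inj_on (\<lambda>i. ?xs ! i) {..<t}"
    using assms len by (intro inj_on_nth) auto
  ultimately show ?thesis unfolding rank_def by (simp add: card_image)
qed

lemma nth_sorted_list_in: "finite L \<Longrightarrow> t < card L \<Longrightarrow> sorted_list_of_set L ! t \<in> L"
  by (metis length_sorted_list_of_set nth_mem set_sorted_list_of_set)

lemma sorted_list_nth_rank:
  assumes "finite L" "p \<in> L"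
  shows "sorted_list_of_set L ! rank L p = p" "rank L p < card L"
proof -
  have "p \<in> set (sorted_list_of_set L)" using assms by simp
  then obtain t where t: "t < card L" "sorted_list_of_set L ! t = p"
    by (metis in_set_conv_nth length_sorted_list_of_set)
  then have "rank L p = t" using rank_nth_sorted_list[OF assms(1) t(1)] by simp
  then show "sorted_list_of_set L ! rank L p = p" "rank L p < card L" using t by auto
qed

lemma bij_betw_rank:
  assumes "finite L"
  shows "bij_betw (rank L) L {..<card L}"
  by (rule bij_betw_byWitness[where f' = "\<lambda>t. sorted_list_of_set L ! t"])
    (use assms in \<open>auto simp: sorted_list_nth_rank rank_nth_sorted_list nth_sorted_list_in\<close>)

lemma letters_le_rank:
  assumes "finite L" "length M = card L"
  shows "letters_le M i = card {p \<in> L. M ! rank L p \<le> i}"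
proof -
  have "bij_betw (rank L) {p \<in> L. M ! rank L p \<le> i} {j. j < length M \<and> M ! j \<le> i}"
    by (rule bij_betw_restrict_preimage[OF bij_betw_rank[OF assms(1)]])
      (use assms sorted_list_nth_rank in auto)
  then show ?thesis unfolding letters_le_def by (simp add: bij_betw_same_card)
qed

lemma letters_le_map:
  assumes "distinct xs"
  shows "letters_le (map f xs) i = card {x \<in> set xs. f x \<le> i}"
proof -
  have "bij_betw (\<lambda>j. xs ! j) {j. j < length (map f xs) \<and> map f xs ! j \<le> i} {x \<in> set xs. f x \<le> i}"
    by (rule bij_betw_restrict_preimage[OF bij_betw_nth[OF assms refl refl]]) auto
  then show ?thesis unfolding letters_le_def by (simp add: bij_betw_same_card)
qed

lemma map_letters: "map (\<lambda>p. w ! (p - 1)) [1..<Suc (length w)] = w"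
  by (rule nth_equalityI) (auto simp: nth_append simp del: upt_Suc)

lemma letters_le_positions: "letters_le w i = card {p \<in> {1..length w}. w ! (p - 1) \<le> i}"
proof -
  have "{p. Suc 0 \<le> p \<and> p < Suc (length w) \<and> w ! (p - Suc 0) \<le> i} = {p. Suc 0 \<le> p \<and> p \<le> length w \<and> w ! (p - Suc 0) \<le> i}"
    by auto
  then show ?thesis
    using letters_le_map[of "[1..<Suc (length w)]" "\<lambda>p. w ! (p - 1)" i]
    unfolding map_letters by (simp del: upt_Suc)
qed

lemma card_letters_between:
  assumes "a \<le> b"
  shows "card {p \<in> {1..length w}. a < w ! (p - 1) \<and> w ! (p - 1) \<le> b} + letters_le w a = letters_le w b"
proof -
  have "{p \<in> {1..length w}. w ! (p - 1) \<le> b} = {p \<in> {1..length w}. a < w ! (p - 1) \<and> w ! (p - 1) \<le> b}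
      \<union> {p \<in> {1..length w}. w ! (p - 1) \<le> a}" using assms by auto
  then show ?thesis unfolding letters_le_positions by (subst card_Un_disjoint[symmetric]) auto
qed

lemma parking_letter_le:
  assumes "parking u" "x \<in> set u"
  shows "x \<le> length u"
proof -
  have "length u \<ge> 1" using assms(2) by (cases u) auto
  then have "length u \<le> letters_le u (length u)" using assms(1) by (auto simp: parking_iff)
  then have "{j. j < length u \<and> u ! j \<le> length u} = {..<length u}"
    unfolding letters_le_def by (intro card_seteq) auto
  then show ?thesis using assms(2) by (auto simp: in_set_conv_nth)
qed

section \<open>Columns as intervals of values under \<open>Phi\<close>\<close>

definition col_off :: "biword \<Rightarrow> nat \<Rightarrow> nat" where
  "col_off m j = (\<Sum>q<j. col_size (fst (m q)))"

lemma col_off_Suc: "col_off m (Suc j) = col_off m j + col_size (fst (m j))"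
  by (simp add: col_off_def)

definition bw_size :: "biword \<Rightarrow> nat" where
  "bw_size m = card (\<Union>i. fst (m i))"

lemma BW_union:
  assumes "m \<in> BW"
  shows "(\<Union>i. fst (m i)) = {1..bw_size m}"
proof -
  obtain n where "(\<Union>i. fst (m i)) = {1..n}" using assms by (auto simp: BW_def)
  then show ?thesis by (simp add: bw_size_def)
qed

lemma BW_col:
  assumes "m \<in> BW"
  shows "finite (fst (m j))" "fst (m j) \<subseteq> {1..bw_size m}" "prime_parking (snd (m j))"
    "length (snd (m j)) = card (fst (m j))"
proof -
  show sub: "fst (m j) \<subseteq> {1..bw_size m}" using BW_union[OF assms] by blast
  show "finite (fst (m j))" by (rule finite_subset[OF sub]) simp
  show "prime_parking (snd (m j))" "length (snd (m j)) = card (fst (m j))"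
    using assms by (auto simp: BW_def)
qed

lemma BW_disjoint: "m \<in> BW \<Longrightarrow> p \<in> fst (m i) \<Longrightarrow> p \<in> fst (m j) \<Longrightarrow> i = j"
  by (auto simp: BW_def)

lemma col_size_pos: "finite L \<Longrightarrow> 0 < col_size L"
  by (auto simp: col_size_def card_gt_0_iff)

lemma card_le_col_size: "card L \<le> col_size L"
  by (auto simp: col_size_def)

lemma col_off_mono: "i \<le> j \<Longrightarrow> col_off m i \<le> col_off m j"
  unfolding col_off_def by (rule sum_mono2) auto

lemma col_off_strict: "m \<in> BW \<Longrightarrow> i < j \<Longrightarrow> col_off m i < col_off m j"
  using col_off_mono[of "Suc i" j m] col_size_pos[OF BW_col(1), of m i] by (simp add: col_off_Suc)

lemma col_off_ge: "m \<in> BW \<Longrightarrow> j \<le> col_off m j"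
proof (induction j)
  case (Suc j)
  then show ?case using col_off_strict[of m j "Suc j"] by simp
qed simp

lemma Phi_length: "length (Phi m) = bw_size m"
  by (simp add: Phi_def bw_size_def del: upt_Suc)

lemma Phi_nth:
  assumes "m \<in> BW" "p \<in> fst (m j)"
  shows "Phi m ! (p - 1) = snd (m j) ! rank (fst (m j)) p + col_off m j"
proof -
  have "p \<in> {1..bw_size m}" using assms BW_col(2) by blast
  moreover have "(THE j. p \<in> fst (m j)) = j" using assms BW_disjoint by (intro the_equality) auto
  ultimately show ?thesis
    by (auto simp: Phi_def Let_def bw_size_def[symmetric] rank_def col_off_def simp del: upt_Suc)
qed

text \<open>A parking function of length \<open>l\<close> has its letters in \<open>{1..l}\<close>.
  The columns therefore use consecutive disjoint intervals of values, where an empty column takes up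
  one value that is no letter.\<close>

lemma Phi_letter:
  assumes "m \<in> BW" "p \<in> fst (m j)"
  shows "col_off m j < Phi m ! (p - 1)" "Phi m ! (p - 1) \<le> col_off m (Suc j)"
proof -
  let ?x = "snd (m j) ! rank (fst (m j)) p"
  have r: "rank (fst (m j)) p < length (snd (m j))"
    using sorted_list_nth_rank(2) BW_col(1,4) assms by simp
  then have x: "?x \<in> set (snd (m j))" by simp
  have pk: "parking (snd (m j))" using BW_col(3)[OF assms(1)] by (simp add: prime_parking_def)
  have "1 \<le> ?x" using pk x by (auto simp: parking_def is_word_def)
  moreover have "?x \<le> card (fst (m j))" using parking_letter_le[OF pk x] BW_col(4)[OF assms(1)] by simp
  ultimately show "col_off m j < Phi m ! (p - 1)" "Phi m ! (p - 1) \<le> col_off m (Suc j)"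
    using card_le_col_size[of "fst (m j)"] unfolding Phi_nth[OF assms] col_off_Suc by simp_all
qed

lemma Phi_col:
  assumes "m \<in> BW"
  shows "fst (m j) = {p \<in> {1..bw_size m}. col_off m j < Phi m ! (p - 1) \<and> Phi m ! (p - 1) \<le> col_off m (Suc j)}"
proof (intro set_eqI iffI)
  fix p assume "p \<in> fst (m j)"
  then show "p \<in> {p \<in> {1..bw_size m}. col_off m j < Phi m ! (p - 1) \<and> Phi m ! (p - 1) \<le> col_off m (Suc j)}"
    using Phi_letter[OF assms] BW_col(2)[OF assms] by blast
next
  fix p assume p: "p \<in> {p \<in> {1..bw_size m}. col_off m j < Phi m ! (p - 1) \<and> Phi m ! (p - 1) \<le> col_off m (Suc j)}"
  then obtain i where i: "p \<in> fst (m i)" using BW_union[OF assms] by blast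
  note * = Phi_letter[OF assms i]
  have "\<not> i < j"
  proof
    assume "i < j"
    then show False using * p col_off_mono[of "Suc i" j m] by simp
  qed
  moreover have "\<not> j < i"
  proof
    assume "j < i"
    then show False using * p col_off_mono[of "Suc j" i m] by simp
  qed
  ultimately show "p \<in> fst (m j)" using i by simp
qed

lemma is_word_Phi:
  assumes "m \<in> BW"
  shows "is_word (Phi m)"
  unfolding is_word_def
proof
  fix x assume "x \<in> set (Phi m)"
  then obtain k where k: "k < bw_size m" "x = Phi m ! k" by (auto simp: in_set_conv_nth Phi_length)
  then have "Suc k \<in> (\<Union>i. fst (m i))" using BW_union[OF assms] by simp
  then obtain j where "Suc k \<in> fst (m j)" by blast
  then show "1 \<le> x" using Phi_letter(1)[OF assms, of "Suc k" j] k by simp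
qed

lemma card_Phi_letters:
  assumes "m \<in> BW" "i \<le> col_size (fst (m j))"
  shows "card {p \<in> {1..bw_size m}. col_off m j < Phi m ! (p - 1) \<and> Phi m ! (p - 1) \<le> col_off m j + i}
    = letters_le (snd (m j)) i"
proof -
  have "{p \<in> {1..bw_size m}. col_off m j < Phi m ! (p - 1) \<and> Phi m ! (p - 1) \<le> col_off m j + i}
      = {p \<in> fst (m j). Phi m ! (p - 1) \<le> col_off m j + i}"
  proof -
    have "col_off m j + i \<le> col_off m (Suc j)" using assms(2) by (simp add: col_off_Suc)
    then show ?thesis by (subst Phi_col[OF assms(1), of j]) auto
  qed
  also have "\<dots> = {p \<in> fst (m j). snd (m j) ! rank (fst (m j)) p \<le> i}"
    using Phi_nth[OF assms(1)] by auto
  finally show ?thesis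
    by (simp only: letters_le_rank[OF BW_col(1)[OF assms(1)] BW_col(4)[OF assms(1)]])
qed

text \<open>Compared with \<open>col_off m j\<close>, the right-hand side misses one for each empty
  column among the first \<open>j\<close>; this deficit is what parkization detects.\<close>

lemma letters_le_col_off:
  assumes "m \<in> BW"
  shows "letters_le (Phi m) (col_off m j) = (\<Sum>q<j. card (fst (m q)))"
proof (induction j)
  case 0
  have "1 \<le> Phi m ! j" if "j < length (Phi m)" for j
    using is_word_Phi[OF assms] nth_mem[OF that] by (simp add: is_word_def)
  then show ?case by (force simp: letters_le_def col_off_def)
next
  case (Suc j)
  have "card (fst (m j)) + letters_le (Phi m) (col_off m j) = letters_le (Phi m) (col_off m (Suc j))"
    using card_letters_between[of "col_off m j" "col_off m (Suc j)" "Phi m"] col_off_mono[of j "Suc j" m]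
    by (simp add: Phi_col[OF assms, of j] Phi_length)
  then show ?case using Suc by simp
qed

text \<open>Columns are compared from left to right. If, at a common offset, one column had the
  smaller size \<open>l\<close>, primeness of the other would put more than \<open>l\<close> letters
  into the next \<open>l\<close> values, while the smaller column has at most \<open>l\<close>
  there. Equal offset and size give the same positions and letters.\<close>

lemma inj_on_Phi: "inj_on Phi BW"
proof (rule inj_onI)
  fix m m' assume m: "m \<in> BW" and m': "m' \<in> BW" and eq: "Phi m = Phi m'"
  have n: "bw_size m = bw_size m'" using eq Phi_length by metis
  have "\<not> col_size (fst (m j)) < col_size (fst (m' j))"
    if m: "m \<in> BW" and m': "m' \<in> BW" and eq: "Phi m = Phi m'" and off: "col_off m j = col_off m' j" for m m' j
  proof
    let ?l = "col_size (fst (m j))"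
    assume l: "?l < col_size (fst (m' j))"
    have n: "bw_size m = bw_size m'" using eq Phi_length by metis
    have "0 < ?l" using col_size_pos BW_col(1) m by blast
    \<comment> \<open>The larger size is at least 2, so it belongs to a nonempty column and equals
      its cardinality.\<close>
    moreover have "?l < card (fst (m' j))" using l \<open>0 < ?l\<close> by (auto simp: col_size_def split: if_splits)
    ultimately have "?l < letters_le (snd (m' j)) ?l"
      using BW_col(3,4)[OF m'] by (simp add: prime_parking_iff)
    also have "\<dots> = card {p \<in> {1..bw_size m}. col_off m j < Phi m ! (p - 1) \<and> Phi m ! (p - 1) \<le> col_off m j + ?l}"
      using card_Phi_letters[OF m', of ?l j] l eq off n by simp
    also have "\<dots> = card (fst (m j))" using Phi_col[OF m, of j] by (simp add: col_off_Suc)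
    also have "\<dots> \<le> ?l" by (rule card_le_col_size)
    finally show False by simp
  qed
  note size = this
  have step: "m j = m' j" if off: "col_off m j = col_off m' j" for j
  proof -
    have "col_size (fst (m j)) = col_size (fst (m' j))"
      using size[OF m m' eq off] size[OF m' m eq[symmetric] off[symmetric]] by simp
    then have "col_off m (Suc j) = col_off m' (Suc j)" using off by (simp add: col_off_Suc)
    then have L: "fst (m j) = fst (m' j)"
      unfolding Phi_col[OF m, of j] Phi_col[OF m', of j] using off eq n by simp
    have "snd (m j) = snd (m' j)"
    proof (rule nth_equalityI)
      show "length (snd (m j)) = length (snd (m' j))" using BW_col(4) m m' L by simp
      fix t assume "t < length (snd (m j))"
      then have t: "t < card (fst (m j))" using BW_col(4)[OF m] by simp
      let ?p = "sorted_list_of_set (fst (m j)) ! t"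
      have p: "?p \<in> fst (m j)" using nth_sorted_list_in[OF BW_col(1)[OF m]] t by blast
      have r: "rank (fst (m j)) ?p = t" using rank_nth_sorted_list t BW_col(1)[OF m] by blast
      have "snd (m j) ! t + col_off m j = snd (m' j) ! t + col_off m' j"
        using Phi_nth[OF m p] Phi_nth[OF m', of ?p j] p L r eq by simp
      then show "snd (m j) ! t = snd (m' j) ! t" using off by simp
    qed
    then show ?thesis using L by (simp add: prod_eq_iff)
  qed
  have "col_off m j = col_off m' j" for j
  proof (induction j)
    case (Suc j)
    then show ?case using step[OF Suc] by (simp add: col_off_Suc)
  qed (simp add: col_off_def)
  then show "m = m'" using step by blast
qed

section \<open>The inverse of \<open>Phi\<close>\<close>

text \<open>The columns of a word: from the offset \<open>o\<close>, the next column ends at the first value \<open>i\<close> for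
  which at most \<open>i - o\<close> letters lie in \<open>(o, i]\<close>.\<close>

definition next_off :: "nat list \<Rightarrow> nat \<Rightarrow> nat" where
  "next_off w o1 = (LEAST i. o1 < i \<and> letters_le w i + o1 \<le> i + letters_le w o1)"

primrec word_off :: "nat list \<Rightarrow> nat \<Rightarrow> nat" where
  "word_off w 0 = 0"
| "word_off w (Suc j) = next_off w (word_off w j)"

definition word_col :: "nat list \<Rightarrow> nat \<Rightarrow> nat set" where
  "word_col w j = {p \<in> {1..length w}. word_off w j < w ! (p - 1) \<and> w ! (p - 1) \<le> word_off w (Suc j)}"

definition biword_of :: "nat list \<Rightarrow> biword" where
  "biword_of w j = (word_col w j, map (\<lambda>p. w ! (p - 1) - word_off w j) (sorted_list_of_set (word_col w j)))"

lemma next_off: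
  shows "o1 < next_off w o1" "letters_le w (next_off w o1) + o1 \<le> next_off w o1 + letters_le w o1"
    "\<And>i. o1 < i \<Longrightarrow> i < next_off w o1 \<Longrightarrow> i + letters_le w o1 < letters_le w i + o1"
proof -
  let ?P = "\<lambda>i. o1 < i \<and> letters_le w i + o1 \<le> i + letters_le w o1"
  \<comment> \<open>There are only \<open>length w\<close> letters, so the surplus is gone at
    \<open>o1 + length w + 1\<close> at the latest.\<close>
  have "letters_le w (o1 + length w + 1) \<le> card {..<length w}"
    unfolding letters_le_def by (rule card_mono) auto
  then have "?P (o1 + length w + 1)" by simp
  then have "?P (next_off w o1)" unfolding next_off_def by (rule LeastI)
  then show "o1 < next_off w o1" "letters_le w (next_off w o1) + o1 \<le> next_off w o1 + letters_le w o1" by auto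
  show "i + letters_le w o1 < letters_le w i + o1" if "o1 < i" "i < next_off w o1" for i
    using not_less_Least[of i ?P] that unfolding next_off_def by simp
qed

text \<open>Let \<open>l\<close> be the length of the interval. By minimality its first
  \<open>i\<close> values hold more than \<open>i\<close> letters for \<open>1 \<le> i < l\<close>,
  and the whole interval holds at most \<open>l\<close>. If \<open>l > 1\<close>, then
  \<open>i = l - 1\<close> forces exactly \<open>l\<close> letters; if \<open>l = 1\<close>, there
  is one letter or none, and an empty column also has size 1.\<close>

lemma word_col_size:
  assumes "is_word w"
  shows "col_size (word_col w j) = word_off w (Suc j) - word_off w j"
    "prime_parking (snd (biword_of w j))"
proof -
  let ?o = "word_off w j"
  let ?l = "word_off w (Suc j) - ?o"
  let ?L = "word_col w j"
  let ?M = "snd (biword_of w j)"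
  have lt: "?o < word_off w (Suc j)" using next_off(1) by simp
  have fin: "finite ?L" by (simp add: word_col_def)
  have cnt: "card {p \<in> ?L. w ! (p - 1) - ?o \<le> i} + letters_le w ?o = letters_le w (?o + i)" if "i \<le> ?l" for i
  proof -
    have "{p \<in> ?L. w ! (p - 1) - ?o \<le> i} = {p \<in> {1..length w}. ?o < w ! (p - 1) \<and> w ! (p - 1) \<le> ?o + i}"
      using that lt unfolding word_col_def by auto
    then show ?thesis using card_letters_between[of ?o "?o + i" w] by simp
  qed
  have LM: "letters_le ?M i = card {p \<in> ?L. w ! (p - 1) - ?o \<le> i}" for i
    using letters_le_map[of "sorted_list_of_set ?L" "\<lambda>p. w ! (p - 1) - ?o" i] fin
    by (simp add: biword_of_def)
  have all: "{p \<in> ?L. w ! (p - 1) - ?o \<le> ?l} = ?L" by (auto simp: word_col_def)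
  have le: "card ?L \<le> ?l"
    using next_off(2)[of w ?o] cnt[of ?l] lt unfolding all by simp
  have prime: "i < letters_le ?M i" if "1 \<le> i" "i < ?l" for i
  proof -
    have "?o + i < next_off w ?o" using that by simp
    then show ?thesis using next_off(3)[of ?o "?o + i" w] cnt[of i] that unfolding LM by simp
  qed
  have mono: "letters_le ?M i \<le> card ?L" for i unfolding LM using fin by (auto intro: card_mono)
  have size: "card ?L = ?l" if "?L \<noteq> {}"
  proof (cases "?l = 1")
    case True
    then show ?thesis using le fin that by (simp add: le_Suc_eq)
  next
    case False
    then have "?l - 1 < letters_le ?M (?l - 1)" using lt by (intro prime) auto
    then show ?thesis using mono[of "?l - 1"] le by linarith
  qed
  show cs: "col_size ?L = ?l"
  proof (cases "?L = {}")
    case True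
    have "?l = 1"
    proof (rule ccontr)
      assume "?l \<noteq> 1"
      then have "1 < letters_le ?M 1" using lt by (intro prime) auto
      then show False using mono[of 1] True by simp
    qed
    then show ?thesis using True by (simp add: col_size_def)
  next
    case False
    then show ?thesis using size by (simp add: col_size_def)
  qed
  have len: "length ?M = card ?L" using fin by (simp add: biword_of_def)
  show "prime_parking ?M"
    unfolding prime_parking_iff
  proof (intro conjI ballI impI)
    show w: "is_word ?M" using fin by (auto simp: is_word_def biword_of_def word_col_def)
    show "i < letters_le ?M i" if "i \<in> {1..<length ?M}" for i
      using that le len by (intro prime) auto
    assume "?M \<noteq> []"
    then have ne: "?L \<noteq> {}" using len by auto
    have "{p \<in> ?L. w ! (p - 1) - ?o \<le> 1} \<noteq> {}"
    proof (cases "?l = 1")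
      case True
      then show ?thesis using ne all by simp
    next
      case False
      then have "1 < letters_le ?M 1" using lt by (intro prime) auto
      then show ?thesis unfolding LM by (metis card.empty not_less_zero)
    qed
    then obtain p where "p \<in> ?L" "w ! (p - 1) - ?o \<le> 1" by blast
    moreover then have "w ! (p - 1) - ?o = 1" by (auto simp: word_col_def)
    ultimately show "1 \<in> set ?M" using fin by (force simp: biword_of_def)
  qed
qed

lemma word_off_ge: "j \<le> word_off w j"
proof (induction j)
  case (Suc j)
  then show ?case using next_off(1)[of "word_off w j" w] by simp
qed simp

lemma biword_of_BW:
  assumes w: "is_word w"
  shows "biword_of w \<in> BW" "Phi (biword_of w) = w"
proof -
  have mono: "word_off w i \<le> word_off w j" if "i \<le> j" for i j
    using that by (rule lift_Suc_mono_le[rotated]) (simp add: less_imp_le[OF next_off(1)])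
  have sub: "word_col w j \<subseteq> {1..length w}" for j by (auto simp: word_col_def)
  have cover: "\<exists>j. p \<in> word_col w j" if p: "p \<in> {1..length w}" for p
  proof -
    let ?x = "w ! (p - 1)"
    \<comment> \<open>The first column whose upper end reaches the letter contains it.\<close>
    define j where "j = (LEAST j. ?x \<le> word_off w (Suc j))"
    have "?x \<le> word_off w (Suc ?x)" using word_off_ge[of "Suc ?x" w] by linarith
    then have 1: "?x \<le> word_off w (Suc j)" unfolding j_def by (rule LeastI)
    have 2: "word_off w j < ?x"
    proof (cases j)
      case 0
      have "?x \<in> set w" using p by (intro nth_mem) auto
      then show ?thesis using w 0 by (auto simp: is_word_def Suc_le_eq)
    next
      case (Suc i)
      then show ?thesis using not_less_Least[of i "\<lambda>j. ?x \<le> word_off w (Suc j)"] unfolding j_def by simp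
    qed
    show ?thesis using p 1 2 by (auto simp: word_col_def)
  qed
  have U: "(\<Union>i. fst (biword_of w i)) = {1..length w}" using sub cover by (auto simp: biword_of_def)
  have dis: "i = j" if "p \<in> word_col w i" "p \<in> word_col w j" for i j p
  proof (rule ccontr)
    assume "i \<noteq> j"
    then consider "Suc i \<le> j" | "Suc j \<le> i" by linarith
    then show False using that mono[of "Suc i" j] mono[of "Suc j" i] by cases (auto simp: word_col_def)
  qed
  show BW: "biword_of w \<in> BW"
    unfolding BW_def
  proof (intro CollectI conjI exI allI impI)
    show "(\<Union>i. fst (biword_of w i)) = {1..length w}" by (rule U)
    show "fst (biword_of w i) \<inter> fst (biword_of w j) = {}" if "i \<noteq> j" for i j
      using dis that by (auto simp: biword_of_def)
    show "prime_parking (snd (biword_of w i))" for i by (rule word_col_size(2)[OF w])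
    show "length (snd (biword_of w i)) = card (fst (biword_of w i))" for i
      by (simp add: biword_of_def)
  qed
  have off: "col_off (biword_of w) j = word_off w j" for j
  proof (induction j)
    case (Suc j)
    then show ?case using word_col_size(1)[OF w, of j] mono[of j "Suc j"]
      by (simp add: col_off_Suc biword_of_def)
  qed (simp add: col_off_def)
  have n: "bw_size (biword_of w) = length w" using U by (simp add: bw_size_def)
  show "Phi (biword_of w) = w"
  proof (rule nth_equalityI)
    show "length (Phi (biword_of w)) = length w" by (simp add: Phi_length n)
    fix k assume "k < length (Phi (biword_of w))"
    then have "Suc k \<in> {1..length w}" by (simp add: Phi_length n)
    then obtain j where j: "Suc k \<in> word_col w j" using cover by blast
    have fin: "finite (word_col w j)" by (simp add: word_col_def)
    have "Phi (biword_of w) ! (Suc k - 1) = w ! (Suc k - 1) - word_off w j + word_off w j"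
      using Phi_nth[OF BW, of "Suc k" j] j sorted_list_nth_rank[OF fin j] fin
      by (simp add: biword_of_def off)
    then show "Phi (biword_of w) ! k = w ! k" using j by (auto simp: word_col_def)
  qed
qed

lemma biword_of_Phi: "m \<in> BW \<Longrightarrow> biword_of (Phi m) = m"
  by (rule inj_onD[OF inj_on_Phi]) (simp_all add: biword_of_BW is_word_Phi)

lemma the_inv_into_Phi: "is_word w \<Longrightarrow> the_inv_into BW Phi w = biword_of w"
  using the_inv_into_f_f[OF inj_on_Phi biword_of_BW(1)] biword_of_BW(2) by metis

lemma bw_size_biword_of: "is_word w \<Longrightarrow> bw_size (biword_of w) = length w"
  using Phi_length[of "biword_of w"] biword_of_BW(2) by simp

section \<open>Parkization as deletion of empty columns\<close>

definition columns :: "biword \<Rightarrow> (nat set \<times> nat list) set" where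
  "columns m = m ` {j. fst (m j) \<noteq> {}}"

definition del_col :: "nat \<Rightarrow> biword \<Rightarrow> biword" where
  "del_col k m = (\<lambda>j. if j < k then m j else m (Suc j))"

lemma del_col_eq: "del_col k m = m \<circ> (\<lambda>j. if j < k then j else Suc j)"
  by (auto simp: del_col_def)

lemma range_skip: "range (\<lambda>j. if j < k then j else Suc j) = - {k}"
proof -
  have "x \<in> range (\<lambda>j. if j < k then j else Suc j)" if "x \<noteq> k" for x
  proof (cases "x < k")
    case False
    then have "x = (if x - 1 < k then x - 1 else Suc (x - 1))" using that by auto
    then show ?thesis by blast
  qed (auto intro: image_eqI[of _ _ x])
  then show ?thesis by (auto split: if_splits)
qed

context
  fixes m k
  assumes m: "m \<in> BW" and empty: "fst (m k) = {}"
begin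

lemma del_col_union: "(\<Union>i. fst (del_col k m i)) = (\<Union>i. fst (m i))"
proof -
  have "(\<Union>i. fst (del_col k m i)) = (\<Union>i\<in>- {k}. fst (m i))"
    unfolding range_skip[of k, symmetric] del_col_eq comp_def by blast
  also have "\<dots> = (\<Union>i. fst (m i))"
  proof -
    have "p \<in> (\<Union>i\<in>- {k}. fst (m i))" if "p \<in> fst (m i)" for p i
      using that empty by (cases "i = k") auto
    then show ?thesis by auto
  qed
  finally show ?thesis .
qed

lemma columns_del_col: "columns (del_col k m) = columns m"
proof -
  let ?f = "\<lambda>j. if j < k then j else Suc j"
  have "columns (del_col k m) = m ` {j \<in> range ?f. fst (m j) \<noteq> {}}"
    unfolding columns_def del_col_eq comp_def by blast
  also have "\<dots> = m ` {j \<in> - {k}. fst (m j) \<noteq> {}}" unfolding range_skip ..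
  also have "{j \<in> - {k}. fst (m j) \<noteq> {}} = {j. fst (m j) \<noteq> {}}" using empty by auto
  finally show ?thesis by (simp add: columns_def)
qed

lemma del_col_BW: "del_col k m \<in> BW"
proof -
  have "fst (del_col k m i) \<inter> fst (del_col k m j) = {}" if "i \<noteq> j" for i j
  proof -
    have "(if i < k then i else Suc i) \<noteq> (if j < k then j else Suc j)" using that by auto
    then show ?thesis using BW_disjoint[OF m] unfolding del_col_eq comp_def by blast
  qed
  moreover have "prime_parking (snd (del_col k m i)) \<and> length (snd (del_col k m i)) = card (fst (del_col k m i))" for i
    using BW_col[OF m] by (simp add: del_col_def)
  moreover have "\<exists>n. (\<Union>i. fst (del_col k m i)) = {1..n}" unfolding del_col_union using BW_union[OF m] by blast
  ultimately show ?thesis unfolding BW_def by blast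
qed

lemma col_off_del_col:
  "j \<le> k \<Longrightarrow> col_off (del_col k m) j = col_off m j"
  "k \<le> j \<Longrightarrow> col_off (del_col k m) j + 1 = col_off m (Suc j)"
proof -
  show le: "j \<le> k \<Longrightarrow> col_off (del_col k m) j = col_off m j" for j
    unfolding col_off_def by (rule sum.cong) (auto simp: del_col_def)
  show "k \<le> j \<Longrightarrow> col_off (del_col k m) j + 1 = col_off m (Suc j)"
  proof (induction rule: dec_induct)
    case base
    then show ?case using le[of k] empty by (simp add: col_off_Suc col_size_def)
  next
    case (step j)
    then show ?case by (simp add: col_off_Suc del_col_def)
  qed
qed

text \<open>The empty column occupies the value \<open>col_off m k + 1\<close>, which is no letter.
  Columns to its left keep their offsets; those to its right have larger letters and move down by
  its size 1.\<close>

lemma Phi_del_col: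
  "Phi (del_col k m) = map (\<lambda>x. if col_off m k + 1 < x then x - 1 else x) (Phi m)"
proof (rule nth_equalityI)
  have n: "bw_size (del_col k m) = bw_size m" unfolding bw_size_def del_col_union ..
  show "length (Phi (del_col k m)) = length (map (\<lambda>x. if col_off m k + 1 < x then x - 1 else x) (Phi m))"
    by (simp add: Phi_length n)
  fix i assume "i < length (Phi (del_col k m))"
  then have i: "i < bw_size m" by (simp add: Phi_length n)
  then have "Suc i \<in> (\<Union>j. fst (m j))" using BW_union[OF m] by simp
  then obtain j where j: "Suc i \<in> fst (m j)" by blast
  then have "j \<noteq> k" using empty by auto
  note P = Phi_nth[OF m j] Phi_letter[OF m j]
  have "Phi (del_col k m) ! i = (if col_off m k + 1 < Phi m ! i then Phi m ! i - 1 else Phi m ! i)"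
  proof (cases "j < k")
    case True
    then have d: "del_col k m j = m j" by (simp add: del_col_def)
    have "Phi (del_col k m) ! i = Phi m ! i"
      using Phi_nth[OF del_col_BW, of "Suc i" j] j P(1) True by (simp add: d col_off_del_col)
    moreover have "Phi m ! i \<le> col_off m k"
      using P(3) col_off_mono[of "Suc j" k m] True by simp
    ultimately show ?thesis by simp
  next
    case False
    then obtain j' where j': "j = Suc j'" "k \<le> j'" using \<open>j \<noteq> k\<close> by (cases j) auto
    then have d: "del_col k m j' = m j" by (simp add: del_col_def)
    have "Phi (del_col k m) ! i + 1 = Phi m ! i"
      using Phi_nth[OF del_col_BW, of "Suc i" j'] j P(1) j' col_off_del_col(2)[of j'] by (simp add: d)
    moreover have "col_off m k + 1 < Phi m ! i"
      using P(2) j' col_off_mono[of "Suc k" j m] col_off_strict[OF m, of k "Suc k"] by simp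
    ultimately show ?thesis by simp
  qed
  then show "Phi (del_col k m) ! i = map (\<lambda>x. if col_off m k + 1 < x then x - 1 else x) (Phi m) ! i"
    using i by (simp add: Phi_length)
qed

text \<open>Up to the first empty column, the count of letters equals the value at each column end,
  and inside a column the parking inequality prevents a deficit. The value taken by the empty column
  adds no letter, which creates the first deficit.\<close>

lemma park_d_Phi:
  assumes first: "\<And>j. j < k \<Longrightarrow> fst (m j) \<noteq> {}"
  shows "park_d (Phi m) = col_off m k + 1"
proof -
  have off: "letters_le (Phi m) (col_off m j) = col_off m j" if "j \<le> k" for j
    unfolding letters_le_col_off[OF m] unfolding col_off_def
    by (rule sum.cong) (use that first in \<open>auto simp: col_size_def\<close>)
  show ?thesis
    unfolding park_d_def letters_le_def[symmetric]
  proof (rule Least_equality)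
    have "letters_le (Phi m) (col_off m (Suc k)) = letters_le (Phi m) (col_off m k)"
      unfolding letters_le_col_off[OF m] using empty by simp
    then have "letters_le (Phi m) (col_off m k + 1) = col_off m k"
      using off[of k] empty by (simp add: col_off_Suc col_size_def)
    then show "1 \<le> col_off m k + 1 \<and> letters_le (Phi m) (col_off m k + 1) < col_off m k + 1" by simp
    fix i assume i: "1 \<le> i \<and> letters_le (Phi m) i < i"
    show "col_off m k + 1 \<le> i"
    proof (rule ccontr)
      assume "\<not> col_off m k + 1 \<le> i"
      then have ik: "i \<le> col_off m k" by simp
      define j where "j = (LEAST j. i \<le> col_off m (Suc j))"
      have "k \<noteq> 0" using ik i by (auto simp: col_off_def intro!: gr0I)
      then obtain k' where k': "k = Suc k'" by (cases k) auto
      have 1: "i \<le> col_off m (Suc j)" unfolding j_def by (rule LeastI[of _ k']) (use ik k' in simp)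
      have "j \<le> k'" unfolding j_def by (rule Least_le) (use ik k' in simp)
      then have jk: "j < k" using k' by simp
      have 2: "col_off m j < i"
      proof (cases j)
        case 0
        then show ?thesis using i by (simp add: col_off_def)
      next
        case (Suc j')
        then show ?thesis using not_less_Least[of j' "\<lambda>j. i \<le> col_off m (Suc j)"] unfolding j_def by simp
      qed
      let ?i = "i - col_off m j"
      have ne: "fst (m j) \<noteq> {}" by (rule first[OF jk])
      have len: "?i \<in> {1..length (snd (m j))}"
        using 1 2 ne BW_col(4)[OF m, of j] by (auto simp: col_off_Suc col_size_def)
      have "parking (snd (m j))" using BW_col(3)[OF m] by (simp add: prime_parking_def)
      then have "?i \<le> letters_le (snd (m j)) ?i" using len by (simp add: parking_iff)
      moreover have "letters_le (snd (m j)) ?i + letters_le (Phi m) (col_off m j) = letters_le (Phi m) i"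
        using card_Phi_letters[OF m, of ?i j] card_letters_between[of "col_off m j" i "Phi m"] 1 2
        by (simp add: col_off_Suc Phi_length)
      ultimately show False using off[of j] jk i 2 by simp
    qed
  qed
qed

end

text \<open>A crude bound, from a letter of column \<open>j\<close> exceeding
  \<open>col_off m j \<ge> j\<close>. It shows that only finitely many columns are nonempty, and
  hence that a first empty column exists.\<close>

lemma nonempty_col_less:
  assumes "m \<in> BW" "fst (m j) \<noteq> {}"
  shows "j < sum_list (Phi m)"
proof -
  obtain p where p: "p \<in> fst (m j)" using assms(2) by blast
  then have "p \<in> {1..bw_size m}" using BW_col(2)[OF assms(1)] by blast
  then have "Phi m ! (p - 1) \<in> set (Phi m)" by (intro nth_mem) (auto simp: Phi_length)
  then have "Phi m ! (p - 1) \<le> sum_list (Phi m)" by (rule member_le_sum_list) simp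
  then show ?thesis using Phi_letter(1)[OF assms(1) p] col_off_ge[OF assms(1), of j] by simp
qed

text \<open>A parkization step deletes the first empty column.\<close>

lemma park_step:
  assumes w: "is_word w"
  defines "w' \<equiv> map (\<lambda>x. if park_d w < x then x - 1 else x) w"
  shows "is_word w'" "columns (biword_of w') = columns (biword_of w)"
proof -
  define m where "m = biword_of w"
  have m: "m \<in> BW" and Pm: "Phi m = w" using biword_of_BW[OF w] by (simp_all add: m_def)
  define k where "k = (LEAST j. fst (m j) = {})"
  have "fst (m (sum_list (Phi m))) = {}" using nonempty_col_less[OF m] by blast
  then have k: "fst (m k) = {}" unfolding k_def by (rule LeastI)
  have first: "fst (m j) \<noteq> {}" if "j < k" for j using not_less_Least that unfolding k_def by blast
  have "w' = Phi (del_col k m)"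
    using Phi_del_col[OF m k] park_d_Phi[OF m k first] by (simp add: w'_def Pm)
  then show "is_word w'" "columns (biword_of w') = columns (biword_of w)"
    using del_col_BW[OF m k] is_word_Phi columns_del_col[OF m k] by (simp_all add: biword_of_Phi m_def)
qed

text \<open>The recursion stops when no \<open>i \<le> length w\<close> has a deficit, which is the
  parking condition; every step before preserves the columns.\<close>

lemma park_columns:
  assumes "is_word w"
  shows "parking (park w) \<and> length (park w) = length w \<and> columns (biword_of (park w)) = columns (biword_of w)"
  using assms
proof (induction w rule: park.induct)
  case (1 w)
  show ?case
  proof (cases "park_d w = length w + 1")
    case True
    have "i \<le> letters_le w i" if "i \<in> {1..length w}" for i
      using not_less_Least[of i "\<lambda>i. 1 \<le> i \<and> letters_le w i < i"] that True
      unfolding park_d_def letters_le_def[symmetric] by auto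
    then have "parking w" using 1(2) by (simp add: parking_iff)
    then show ?thesis using True by (simp add: park.simps[of w])
  next
    case False
    then show ?thesis using 1(1)[OF False] park_step[OF 1(2)] by (simp add: park.simps[of w])
  qed
qed

section \<open>The infinite symmetric group\<close>

lemma S_inf_bij: "\<sigma> \<in> S_inf \<Longrightarrow> bij \<sigma>"
proof (induction rule: S_inf.induct)
  case (step \<sigma> i)
  then show ?case by (intro bij_comp) auto
qed (rule bij_id)

lemma S_inf_comp: "\<sigma> \<in> S_inf \<Longrightarrow> \<tau> \<in> S_inf \<Longrightarrow> \<sigma> \<circ> \<tau> \<in> S_inf"
  by (induction rule: S_inf.induct) (auto simp: comp_assoc intro: S_inf.step)

lemma transpose_S_inf: "Transposition.transpose a b \<in> S_inf"
proof -
  have adj: "Transposition.transpose i (Suc i) \<in> S_inf" for i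
    using S_inf.step[OF S_inf.id, of i] by simp
  have less: "Transposition.transpose a b \<in> S_inf" if "a < b" for a b
    using that
  proof (induction b)
    case (Suc b)
    show ?case
    proof (cases "a = b")
      case True
      then show ?thesis using adj by simp
    next
      case False
      then have "Transposition.transpose a (Suc b)
          = Transposition.transpose b (Suc b) \<circ> (Transposition.transpose a b \<circ> Transposition.transpose b (Suc b))"
        using Suc.prems by (auto simp: fun_eq_iff transpose_def)
      moreover have "Transposition.transpose a b \<in> S_inf" using Suc False by simp
      ultimately show ?thesis using S_inf_comp adj by metis
    qed
  qed simp
  show ?thesis
    using less[of a b] less[of b a] S_inf.id by (cases a b rule: linorder_cases) (auto simp: transpose_commute)
qed

lemma permutes_S_inf:
  assumes "finite K" "\<sigma> permutes K"
  shows "\<sigma> \<in> S_inf"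
  using assms
proof (induction K arbitrary: \<sigma> rule: finite_induct)
  case empty
  then show ?case using S_inf.id by (simp add: id_def)
next
  case (insert a K)
  have "Transposition.transpose a (\<sigma> a) \<circ> \<sigma> \<in> S_inf"
    using insert.IH permutes_insert_lemma[OF insert.prems] by blast
  then have "Transposition.transpose a (\<sigma> a) \<circ> (Transposition.transpose a (\<sigma> a) \<circ> \<sigma>) \<in> S_inf"
    by (rule S_inf_comp[OF transpose_S_inf])
  then show ?case by (simp add: comp_assoc[symmetric])
qed

lemma reindex_BW:
  assumes m: "m \<in> BW" and \<sigma>: "bij \<sigma>"
  shows "m \<circ> \<sigma> \<in> BW" "columns (m \<circ> \<sigma>) = columns m" "bw_size (m \<circ> \<sigma>) = bw_size m"
proof -
  have surj: "\<exists>i. \<sigma> i = j" for j using \<sigma> by (metis bij_pointE)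
  have U: "(\<Union>i. fst ((m \<circ> \<sigma>) i)) = (\<Union>i. fst (m i))"
    using surj by (auto simp: comp_def) metis
  then show "bw_size (m \<circ> \<sigma>) = bw_size m" by (simp add: bw_size_def)
  have "fst (m (\<sigma> i)) \<inter> fst (m (\<sigma> j)) = {}" if "i \<noteq> j" for i j
    using BW_disjoint[OF m, of _ "\<sigma> i" "\<sigma> j"] that bij_is_inj[OF \<sigma>] by (auto dest: injD)
  then show "m \<circ> \<sigma> \<in> BW"
    using U BW_union[OF m] BW_col[OF m] unfolding BW_def by auto
  show "columns (m \<circ> \<sigma>) = columns m"
    unfolding columns_def comp_def
  proof (intro set_eqI iffI)
    fix c assume "c \<in> m ` {j. fst (m j) \<noteq> {}}"
    then obtain j where j: "c = m j" "fst (m j) \<noteq> {}" by blast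
    obtain i where "\<sigma> i = j" using surj by blast
    then show "c \<in> (\<lambda>i. m (\<sigma> i)) ` {j. fst (m (\<sigma> j)) \<noteq> {}}" using j by blast
  qed blast
qed

text \<open>Nonempty columns are matched by content. Every empty column is \<open>({}, [])\<close>,
  so the other indices can be matched arbitrarily; inside the union of the two finite sets of
  nonempty indices equally many remain on both sides, and all further indices are fixed.\<close>

lemma columns_eq_imp_reindex:
  assumes m: "m \<in> BW" and m': "m' \<in> BW" and eq: "columns m = columns m'"
  shows "\<exists>\<sigma>\<in>S_inf. m' = m \<circ> \<sigma>"
proof -
  define I where "I m = {j. fst (m j) \<noteq> {}}" for m :: biword
  have finI: "finite (I m)" if "m \<in> BW" for m
    by (rule finite_subset[of _ "{..<sum_list (Phi m)}"]) (use nonempty_col_less[OF that] in \<open>auto simp: I_def\<close>)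
  have inj: "inj_on m (I m)" if "m \<in> BW" for m
    using BW_disjoint[OF that] by (intro inj_onI) (auto simp: I_def)
  have bm: "bij_betw m (I m) (columns m)" if "m \<in> BW" for m
    using inj[OF that] by (auto simp: bij_betw_def columns_def I_def)
  have empty: "m j = ({}, [])" if "m \<in> BW" "j \<notin> I m" for m j
    using BW_col(4)[OF that(1), of j] that(2) by (auto simp: I_def prod_eq_iff)
  let ?K = "I m \<union> I m'"
  define g where "g = inv_into (I m) m \<circ> m'"
  have g: "bij_betw g (I m') (I m)"
    unfolding g_def using bij_betw_trans[OF bm[OF m', folded eq] bij_betw_inv_into[OF bm[OF m]]] .
  have mg: "m (g j) = m' j" if "j \<in> I m'" for j
  proof -
    have "m' j \<in> m ` I m" using that bm[OF m'] bm[OF m] eq by (auto simp: bij_betw_def)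
    then show ?thesis by (simp add: g_def f_inv_into_f)
  qed
  have "card (?K - I m') = card (?K - I m)"
    using finI[OF m] finI[OF m'] bij_betw_same_card[OF g] by (simp add: card_Diff_subset)
  then obtain h where h: "bij_betw h (?K - I m') (?K - I m)"
    using finI[OF m] finI[OF m'] finite_same_card_bij[of "?K - I m'" "?K - I m"] by auto
  define \<sigma> where "\<sigma> j = (if j \<in> I m' then g j else if j \<in> ?K then h j else j)" for j
  have "bij_betw \<sigma> (I m' \<union> (?K - I m')) (I m \<union> (?K - I m))"
  proof (rule bij_betw_combine)
    show "bij_betw \<sigma> (I m') (I m)" using g by (rule bij_betw_cong[THEN iffD1, rotated]) (simp add: \<sigma>_def)
    show "bij_betw \<sigma> (?K - I m') (?K - I m)" using h by (rule bij_betw_cong[THEN iffD1, rotated]) (auto simp: \<sigma>_def)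
  qed blast
  moreover have "I m' \<union> (?K - I m') = ?K" "I m \<union> (?K - I m) = ?K" by blast+
  ultimately have "\<sigma> permutes ?K" by (intro bij_imp_permutes) (auto simp: \<sigma>_def)
  then have "\<sigma> \<in> S_inf" using finI[OF m] finI[OF m'] by (intro permutes_S_inf) auto
  moreover have "m' j = m (\<sigma> j)" for j
  proof (cases "j \<in> I m'")
    case True
    then show ?thesis using mg by (simp add: \<sigma>_def)
  next
    case False
    have "\<sigma> j \<notin> I m"
    proof (cases "j \<in> ?K")
      case True
      then have "h j \<in> ?K - I m" using False bij_betwE[OF h] by blast
      then show ?thesis using True False by (simp add: \<sigma>_def)
    next
      case F: False
      then show ?thesis using False by (simp add: \<sigma>_def)
    qed
    then show ?thesis using empty[OF m] empty[OF m' False] by simp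
  qed
  ultimately show ?thesis by (intro bexI[of _ \<sigma>]) (auto simp: fun_eq_iff)
qed

text \<open>\<open>series_act\<close> uses \<open>inv \<sigma>\<close> and \<open>col_act\<close>
  inverts once more, so the columns are reindexed by \<open>\<sigma>\<close> itself.\<close>

lemma word_act_inv:
  assumes "is_word w" "\<sigma> \<in> S_inf"
  shows "word_act (inv \<sigma>) w = Phi (biword_of w \<circ> \<sigma>)"
  using assms S_inf_bij[OF assms(2)] by (simp add: word_act_def the_inv_into_Phi col_act_def inv_inv_eq)

section \<open>The dimension of the invariants\<close>

text \<open>A complete invariant of the orbits of \<open>S_inf\<close> on words, by
  \<open>word_act_key\<close> and \<open>key_eq_imp_word_act\<close>.\<close>

definition key :: "nat list \<Rightarrow> (nat set \<times> nat list) set" where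
  "key w = columns (biword_of w)"

lemma word_act_key:
  assumes "is_word w" "\<sigma> \<in> S_inf"
  shows "is_word (word_act (inv \<sigma>) w)" "length (word_act (inv \<sigma>) w) = length w"
    "key (word_act (inv \<sigma>) w) = key w"
proof -
  note R = reindex_BW[OF biword_of_BW(1)[OF assms(1)] S_inf_bij[OF assms(2)]]
  show "is_word (word_act (inv \<sigma>) w)" "length (word_act (inv \<sigma>) w) = length w"
    "key (word_act (inv \<sigma>) w) = key w"
    unfolding word_act_inv[OF assms] key_def
    using is_word_Phi[OF R(1)] R bw_size_biword_of[OF assms(1)]
    by (simp_all add: Phi_length biword_of_Phi)
qed

lemma key_eq_imp_word_act:
  assumes "is_word w" "is_word w'" "key w = key w'"
  shows "\<exists>\<sigma>\<in>S_inf. w' = word_act (inv \<sigma>) w"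
proof -
  obtain \<sigma> where "\<sigma> \<in> S_inf" "biword_of w' = biword_of w \<circ> \<sigma>"
    using columns_eq_imp_reindex[OF biword_of_BW(1) biword_of_BW(1)] assms unfolding key_def by blast
  then show ?thesis using word_act_inv[OF assms(1)] biword_of_BW(2)[OF assms(2)] by metis
qed

definition keys :: "nat \<Rightarrow> (nat set \<times> nat list) set set" where
  "keys n = key ` {w. is_word w \<and> length w = n}"

lemma finite_parking: "finite {u. parking u \<and> length u = n}"
  by (rule finite_subset[of _ "{xs. set xs \<subseteq> {..n} \<and> length xs = n}"])
    (auto simp: finite_lists_length_eq dest: parking_letter_le)

text \<open>Nonempty columns have disjoint first components, so a set of them is the graph of a
  function on its blocks. Conversely, any listing of the blocks followed by empty columns is a
  biword with the prescribed columns.\<close>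

lemma bij_betw_keys:
  "bij_betw (\<lambda>(P, g). (\<lambda>Q. (Q, g Q)) ` P)
     (SIGMA P:{P. partition_on {1..n} P}. PiE P (\<lambda>Q. {u. prime_parking u \<and> length u = card Q})) (keys n)"
  (is "bij_betw ?h ?X _")
  unfolding bij_betw_def
proof
  show "inj_on ?h ?X"
  proof (rule inj_on_inverseI)
    fix x assume "x \<in> ?X"
    then obtain P g where x: "x = (P, g)" and g: "g \<in> PiE P (\<lambda>Q. {u. prime_parking u \<and> length u = card Q})" by auto
    have "(THE M. (Q, M) \<in> (\<lambda>Q. (Q, g Q)) ` P) = g Q" if "Q \<in> P" for Q
      using that by (intro the_equality) auto
    then have "(\<lambda>Q\<in>P. THE M. (Q, M) \<in> (\<lambda>Q. (Q, g Q)) ` P) = g"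
      using g by (auto simp: fun_eq_iff PiE_def extensional_def)
    then show "(\<lambda>C. (fst ` C, \<lambda>Q\<in>fst ` C. THE M. (Q, M) \<in> C)) (?h x) = x"
      by (simp add: x image_image)
  qed
  show "?h ` ?X = keys n"
  proof
    show "?h ` ?X \<subseteq> keys n"
    proof (rule image_subsetI)
      fix x assume "x \<in> ?X"
      then obtain P g where x: "x = (P, g)" and P: "partition_on {1..n} P"
        and g: "g \<in> PiE P (\<lambda>Q. {u. prime_parking u \<and> length u = card Q})" by auto
      have "finite P" using P by (rule finite_elements[OF finite_atLeastAtMost])
      then obtain Qs where Qs: "set Qs = P" "distinct Qs" using finite_distinct_list by blast
      define m :: biword where "m j = (if j < length Qs then (Qs ! j, g (Qs ! j)) else ({}, []))" for j
      have inP: "Qs ! j \<in> P" if "j < length Qs" for j using that Qs by auto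
      have U: "(\<Union>i. fst (m i)) = {1..n}"
      proof -
        have "(\<Union>i. fst (m i)) = (\<Union>i<length Qs. Qs ! i)" by (auto simp: m_def split: if_splits)
        also have "\<dots> = \<Union>P" using Qs(1) by (auto simp: in_set_conv_nth) (metis in_set_conv_nth)
        finally show ?thesis using P by (simp add: partition_on_def)
      qed
      have "fst (m i) \<inter> fst (m j) = {}" if "i \<noteq> j" for i j
      proof (cases "i < length Qs \<and> j < length Qs")
        case True
        then have "Qs ! i \<noteq> Qs ! j" using that Qs(2) by (simp add: nth_eq_iff_index_eq)
        then have "Qs ! i \<inter> Qs ! j = {}" using disjointD[OF partition_onD2[OF P]] inP True by blast
        then show ?thesis using True by (simp add: m_def)
      qed (auto simp: m_def)
      moreover have "prime_parking (snd (m i)) \<and> length (snd (m i)) = card (fst (m i))" for i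
      proof (cases "i < length Qs")
        case True
        then show ?thesis using g inP by (auto simp: m_def PiE_iff)
      qed (simp add: m_def prime_parking_iff is_word_def)
      ultimately have m: "m \<in> BW" using U unfolding BW_def by blast
      have "columns m = (\<lambda>Q. (Q, g Q)) ` P"
      proof -
        have "Qs ! j \<noteq> {}" if "j < length Qs" for j
          using inP[OF that] partition_onD3[OF P] by metis
        then have "{j. fst (m j) \<noteq> {}} = {..<length Qs}"
          by (auto simp: m_def split: if_splits)
        then have "columns m = (\<lambda>j. (Qs ! j, g (Qs ! j))) ` {..<length Qs}"
          unfolding columns_def by (auto simp: m_def)
        also have "\<dots> = (\<lambda>Q. (Q, g Q)) ` ((!) Qs ` {..<length Qs})" by (simp add: image_image)
        also have "(!) Qs ` {..<length Qs} = P" using Qs(1) by (auto simp: in_set_conv_nth)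
        finally show ?thesis .
      qed
      then have "?h x = key (Phi m)" by (simp add: x key_def biword_of_Phi[OF m])
      moreover have "length (Phi m) = n" using U by (simp add: Phi_length bw_size_def)
      ultimately show "?h x \<in> keys n" using is_word_Phi[OF m] by (auto simp: keys_def)
    qed
    show "keys n \<subseteq> ?h ` ?X"
    proof
      fix C assume "C \<in> keys n"
      then obtain w where w: "is_word w" "length w = n" and C: "C = key w" by (auto simp: keys_def)
      define m where "m = biword_of w"
      have m: "m \<in> BW" using biword_of_BW[OF w(1)] by (simp add: m_def)
      have Cm: "C = m ` {j. fst (m j) \<noteq> {}}" by (simp add: C key_def m_def columns_def)
      have U: "(\<Union>i. fst (m i)) = {1..n}" using BW_union[OF m] bw_size_biword_of[OF w(1)] w(2) by (simp add: m_def)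
      have meet: "c = d" if "c \<in> C" "d \<in> C" "p \<in> fst c" "p \<in> fst d" for c d p
        using that BW_disjoint[OF m] unfolding Cm by blast
      have inj: "inj_on fst C"
      proof (rule inj_onI)
        fix c d assume cd: "c \<in> C" "d \<in> C" "fst c = fst d"
        moreover then obtain p where "p \<in> fst c" unfolding Cm by blast
        ultimately show "c = d" using meet by metis
      qed
      have P: "partition_on {1..n} (fst ` C)"
        unfolding partition_on_def
      proof (intro conjI)
        show "\<Union>(fst ` C) = {1..n}" unfolding U[symmetric] Cm by auto
        show "disjoint (fst ` C)" unfolding disjoint_def using meet by blast
        show "{} \<notin> fst ` C" unfolding Cm by auto
      qed
      have prime: "prime_parking (snd c) \<and> length (snd c) = card (fst c)" if "c \<in> C" for c
        using that BW_col(3,4)[OF m] unfolding Cm by auto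
      let ?g = "\<lambda>Q\<in>fst ` C. snd (inv_into C fst Q)"
      have g: "(Q, ?g Q) = inv_into C fst Q" "inv_into C fst Q \<in> C" if "Q \<in> fst ` C" for Q
        using f_inv_into_f[OF that] inv_into_into[OF that] that by (auto simp: prod_eq_iff)
      have "?g \<in> PiE (fst ` C) (\<lambda>Q. {u. prime_parking u \<and> length u = card Q})"
      proof (intro PiE_I)
        fix Q assume Q: "Q \<in> fst ` C"
        have "(Q, ?g Q) \<in> C" using g[OF Q] by simp
        from prime[OF this] show "?g Q \<in> {u. prime_parking u \<and> length u = card Q}" by simp
      qed simp
      moreover have "(\<lambda>Q. (Q, ?g Q)) ` fst ` C = C"
      proof -
        have "(\<lambda>Q. (Q, ?g Q)) ` fst ` C = inv_into C fst ` fst ` C" using g(1) by (intro image_cong) auto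
        also have "\<dots> = C" using inj by (simp add: inv_into_image_cancel)
        finally show ?thesis .
      qed
      ultimately show "C \<in> ?h ` ?X" using P by (intro image_eqI[of _ _ "(fst ` C, ?g)"]) auto
    qed
  qed
qed

lemma card_keys:
  "finite (keys n)" "card (keys n) = (\<Sum>P | partition_on {1..n} P. \<Prod>Q\<in>P. (card Q - 1) ^ (card Q - 1))"
proof -
  let ?Y = "\<lambda>P. PiE P (\<lambda>Q. {u. prime_parking u \<and> length u = card Q})"
  let ?X = "SIGMA P:{P. partition_on {1..n} P}. ?Y P"
  have finP: "finite P" if "partition_on {1..n} P" for P
    using that by (rule finite_elements[OF finite_atLeastAtMost])
  have finPF: "finite {u. prime_parking u \<and> length u = k}" for k
    by (rule finite_subset[OF _ finite_parking[of k]]) (auto simp: prime_parking_def)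
  have fin: "finite {P. partition_on {1..n} P}" "\<forall>P\<in>{P. partition_on {1..n} P}. finite (?Y P)"
    using finP finPF by (auto intro!: finite_PiE finitely_many_partition_on)
  then have "finite ?X" by (intro finite_SigmaI) auto
  then show "finite (keys n)" using bij_betw_finite[OF bij_betw_keys] by blast
  have "card (keys n) = card ?X" using bij_betw_same_card[OF bij_betw_keys] by metis
  also have "\<dots> = (\<Sum>P | partition_on {1..n} P. card (?Y P))" by (rule card_SigmaI[OF fin])
  also have "\<dots> = (\<Sum>P | partition_on {1..n} P. \<Prod>Q\<in>P. (card Q - 1) ^ (card Q - 1))"
  proof (rule sum.cong)
    fix P assume "P \<in> {P. partition_on {1..n} P}"
    then have P: "partition_on {1..n} P" by simp
    have "card {u. prime_parking u \<and> length u = card Q} = (card Q - 1) ^ (card Q - 1)" if "Q \<in> P" for Q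
    proof (rule card_prime_parking)
      have "Q \<subseteq> {1..n}" "Q \<noteq> {}" using P that by (auto simp: partition_on_def)
      then show "1 \<le> card Q" by (simp add: Suc_le_eq card_gt_0_iff finite_subset)
    qed
    then show "card (?Y P) = (\<Prod>Q\<in>P. (card Q - 1) ^ (card Q - 1))" using finP[OF P] by (simp add: card_PiE)
  qed simp
  finally show "card (keys n) = (\<Sum>P | partition_on {1..n} P. \<Prod>Q\<in>P. (card Q - 1) ^ (card Q - 1))" .
qed

section \<open>Indicator series of the orbits as a basis\<close>

definition class_series :: "nat \<Rightarrow> (nat set \<times> nat list) set \<Rightarrow> nat list \<Rightarrow> 'k::field_char_0" where
  "class_series n C = (\<lambda>w. if is_word w \<and> length w = n \<and> key w = C then 1 else 0)"

lemma sum_series_apply: "(\<Sum>x\<in>A. f x) w = (\<Sum>x\<in>A. f x w :: 'k::field_char_0)"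
  by (induction A rule: infinite_finite_induct) auto

text \<open>Parkization preserves length and key, so a class is a union of fibres of
  \<open>park\<close>. The sum is finite because only finitely many parking functions have length
  \<open>n\<close>, even when the class is infinite.\<close>

lemma class_series_eq_sum_G:
  "class_series n C = (\<Sum>u | parking u \<and> length u = n \<and> key u = C. (G u :: nat list \<Rightarrow> 'k::field_char_0))"
proof
  fix w
  let ?U = "{u. parking u \<and> length u = n \<and> key u = C}"
  have fin: "finite ?U" by (rule finite_subset[OF _ finite_parking[of n]]) auto
  show "(class_series n C :: nat list \<Rightarrow> 'k) w = (\<Sum>u\<in>?U. G u) w"
  proof (cases "is_word w")
    case True
    then have "park w \<in> ?U \<longleftrightarrow> length w = n \<and> key w = C"
      using park_columns[OF True] by (auto simp: key_def)
    moreover have "(\<Sum>u\<in>?U. (G u :: nat list \<Rightarrow> 'k) w) = (if park w \<in> ?U then 1 else 0)"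
      using True fin sum.delta[of ?U "park w" "\<lambda>_. 1 :: 'k"] by (simp add: G_def eq_commute)
    ultimately show ?thesis using True by (simp add: class_series_def sum_series_apply)
  next
    case False
    then show ?thesis by (simp add: class_series_def sum_series_apply G_def)
  qed
qed

lemma class_series_PQSym_inf: "(class_series n C :: nat list \<Rightarrow> 'k::field_char_0) \<in> PQSym_inf_comp n"
proof -
  have comp: "(class_series n C :: nat list \<Rightarrow> 'k) \<in> PQSym_comp n"
    unfolding class_series_eq_sum_G PQSym_comp_def by (intro series.span_sum series.span_base) auto
  moreover have "PQSym_comp n \<subseteq> (PQSym :: (nat list \<Rightarrow> 'k) set)"
    unfolding PQSym_comp_def PQSym_def by (intro series.span_mono) auto
  moreover have "series_act \<sigma> (class_series n C) = (class_series n C :: nat list \<Rightarrow> 'k)" if "\<sigma> \<in> S_inf" for \<sigma>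
    using word_act_key[OF _ that] by (auto simp: series_act_def class_series_def fun_eq_iff)
  ultimately show ?thesis by (auto simp: PQSym_inf_comp_def PQSym_inf_def)
qed

lemma PQSym_comp_zero:
  assumes "f \<in> PQSym_comp n" "\<not> (is_word w \<and> length w = n)"
  shows "f w = (0 :: 'k::field_char_0)"
  using assms(1) unfolding PQSym_comp_def
proof (induction rule: series.span_induct_alt)
  case (step c g f)
  then obtain u where "g = G u" "length u = n" by auto
  then have "g w = 0" using assms(2) park_columns[of w] by (auto simp: G_def)
  then show ?case using step by (simp add: scale_series_def)
qed simp

text \<open>Invariance makes coefficients constant on orbits, and equal keys mean equal
  orbits.\<close>

lemma PQSym_inf_key:
  assumes f: "f \<in> PQSym_inf_comp n" and w: "is_word w" "is_word w'" "key w = key w'"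
  shows "f w = (f w' :: 'k::field_char_0)"
proof -
  obtain \<sigma> where \<sigma>: "\<sigma> \<in> S_inf" "w' = word_act (inv \<sigma>) w" using key_eq_imp_word_act[OF w] by blast
  then have "series_act \<sigma> f = f" using f by (auto simp: PQSym_inf_comp_def PQSym_inf_def)
  then have "f w = series_act \<sigma> f w" by simp
  then show ?thesis using w \<sigma> by (simp add: series_act_def)
qed

text \<open>Evaluation at one representative of each class is dual to the indicator series; it
  provides the coefficients for spanning and isolates each coefficient for independence.\<close>

lemma dim_PQSym_inf_comp:
  "series.dim (PQSym_inf_comp n :: (nat list \<Rightarrow> 'k::field_char_0) set) = card (keys n)"
proof -
  let ?c = "class_series n :: _ \<Rightarrow> nat list \<Rightarrow> 'k"
  define rep where "rep C = (SOME w. is_word w \<and> length w = n \<and> key w = C)" for C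
  have rep: "is_word (rep C)" "length (rep C) = n" "key (rep C) = C" if "C \<in> keys n" for C
  proof -
    have "\<exists>w. is_word w \<and> length w = n \<and> key w = C" using that by (auto simp: keys_def)
    then have "is_word (rep C) \<and> length (rep C) = n \<and> key (rep C) = C" unfolding rep_def by (rule someI_ex)
    then show "is_word (rep C)" "length (rep C) = n" "key (rep C) = C" by auto
  qed
  have c_rep: "?c C' (rep C) = (if C' = C then 1 else 0)" if "C \<in> keys n" for C C'
    using rep[OF that] by (auto simp: class_series_def)
  have inj: "inj_on ?c (keys n)"
    by (rule inj_onI) (metis c_rep zero_neq_one)
  show ?thesis
  proof (rule series.dim_unique)
    show "?c ` keys n \<subseteq> PQSym_inf_comp n" using class_series_PQSym_inf by blast
    show "(PQSym_inf_comp n :: (nat list \<Rightarrow> 'k) set) \<subseteq> series.span (?c ` keys n)"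
    proof
      fix f :: "nat list \<Rightarrow> 'k" assume f: "f \<in> PQSym_inf_comp n"
      have "f = (\<Sum>C\<in>keys n. scale_series (f (rep C)) (?c C))"
      proof
        fix w
        show "f w = (\<Sum>C\<in>keys n. scale_series (f (rep C)) (?c C)) w"
        proof (cases "is_word w \<and> length w = n")
          case True
          then have k: "key w \<in> keys n" by (auto simp: keys_def)
          have "(\<Sum>C\<in>keys n. scale_series (f (rep C)) (?c C)) w = (\<Sum>C\<in>keys n. if key w = C then f (rep C) else 0)"
            unfolding sum_series_apply using True
            by (intro sum.cong) (auto simp: scale_series_def class_series_def)
          also have "\<dots> = f (rep (key w))" using k card_keys(1)[of n] by simp
          also have "\<dots> = f w" using PQSym_inf_key[OF f] rep[OF k] True by blast
          finally show ?thesis by simp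
        next
          case False
          then have "f w = 0" using f PQSym_comp_zero by (auto simp: PQSym_inf_comp_def)
          moreover have "(\<Sum>C\<in>keys n. scale_series (f (rep C)) (?c C)) w = 0"
            unfolding sum_series_apply using False
            by (intro sum.neutral) (auto simp: scale_series_def class_series_def)
          ultimately show ?thesis by simp
        qed
      qed
      then show "f \<in> series.span (?c ` keys n)"
        by (metis (no_types, lifting) imageI series.span_base series.span_scale series.span_sum)
    qed
    show "series.independent (?c ` keys n)"
    proof (rule series.independent_if_scalars_zero)
      show "finite (?c ` keys n)" using card_keys(1) by simp
      fix a x assume z: "(\<Sum>x\<in>?c ` keys n. scale_series (a x) x) = 0" and x: "x \<in> ?c ` keys n"
      obtain C where C: "C \<in> keys n" "x = ?c C" using x by blast
      have "0 = (\<Sum>x\<in>?c ` keys n. scale_series (a x) x) (rep C)" by (simp add: z)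
      also have "\<dots> = (\<Sum>C'\<in>keys n. a (?c C') * ?c C' (rep C))"
        unfolding sum_series_apply by (subst sum.reindex[OF inj]) (simp add: scale_series_def)
      also have "\<dots> = (\<Sum>C'\<in>keys n. if C' = C then a (?c C') else 0)"
        using c_rep[OF C(1)] by (intro sum.cong) auto
      also have "\<dots> = a x" using C card_keys(1)[of n] by simp
      finally show "a x = 0" by simp
    qed
    show "card (?c ` keys n) = card (keys n)" by (rule card_image[OF inj])
  qed
qed

text \<open>Partitions are grouped by their number of blocks. Since blocks are nonempty and disjoint
  there are at most \<open>n\<close> of them, and \<open>n \<ge> 1\<close> gives at least
  one.\<close>

lemma sum_A_inf:
  assumes "n \<ge> 1"
  shows "(\<Sum>k=1..n. A_inf n k) = (\<Sum>P | partition_on {1..n} P. \<Prod>Q\<in>P. (card Q - 1) ^ (card Q - 1))"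
proof -
  let ?S = "{P. partition_on {1..n} P}"
  have "card P \<in> {1..n}" if "P \<in> ?S" for P
  proof -
    have P: "partition_on {1..n} P" using that by simp
    have fin: "finite P" using P by (rule finite_elements[OF finite_atLeastAtMost])
    have Q: "finite Q" "Q \<noteq> {}" if "Q \<in> P" for Q
    proof -
      have "Q \<subseteq> {1..n}" using P that by (auto simp: partition_on_def)
      then show "finite Q" by (rule finite_subset) simp
      show "Q \<noteq> {}" using P that by (auto simp: partition_on_def)
    qed
    have "card P = (\<Sum>Q\<in>P. 1)" by simp
    also have "\<dots> \<le> (\<Sum>Q\<in>P. card Q)"
      using Q by (intro sum_mono) (simp add: Suc_le_eq card_gt_0_iff)
    also have "\<dots> = card (\<Union>P)"
      using P Q by (intro card_Union_disjoint[symmetric])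
        (auto simp: partition_on_def disjoint_def pairwise_def disjnt_def)
    also have "\<dots> = n" using P by (simp add: partition_on_def)
    finally have "card P \<le> n" .
    moreover have "P \<noteq> {}" using P assms by (auto simp: partition_on_def)
    ultimately show ?thesis using fin by (simp add: Suc_le_eq card_gt_0_iff)
  qed
  then have "(\<Sum>k\<in>{1..n}. \<Sum>P\<in>{P \<in> ?S. card P = k}. \<Prod>Q\<in>P. (card Q - 1) ^ (card Q - 1))
      = (\<Sum>P\<in>?S. \<Prod>Q\<in>P. (card Q - 1) ^ (card Q - 1))"
    by (intro sum.group) (auto intro: finitely_many_partition_on)
  then show ?thesis by (simp add: A_inf_def)
qed

theorem mainTheorem4:
  fixes n :: nat
  assumes "n \<ge> 1"
  shows "series.dim (PQSym_inf_comp n :: (nat list \<Rightarrow> 'k::field_char_0) set) = (\<Sum>k=1..n. A_inf n k)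
    \<and> (\<Sum>k=1..n. A_inf n k) = card (chain_trees n)"
  unfolding dim_PQSym_inf_comp card_keys(2) sum_A_inf[OF assms] card_chain_trees[OF assms]
  by (simp add: card_min_forests)

end
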